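(* Let $n_1\le n_2$, let $\mathcal{A}:\mathbb{R}^{n_1\times n_2}\to\mathbb{R}^m$ be a linear map and let $b\in\mathbb{R}^m$. Let $X_0$ be the optimal solution of the rank minimization problem $$\text{minimize } \operatorname{rank}(X)\quad\text{subject to } \mathcal{A}(X)=b,$$ and assume that $X_0$ has rank $r<n_1/2$. Then: 1. If for every $Y$ in the null space of $\mathcal{A}$ and for every decomposition $Y=Y_1+Y_2$, where $Y_1$ has rank $r$ and $Y_2$ has rank greater than $r$, it holds that $$\|Y_1\|_*<\|Y_2\|_*,$$ then $X_0$ is the unique minimizer of the problem $$\text{minimize } \|X\|_*\quad\text{subject to } \mathcal{A}(X)=b.$$ 2. Conversely, if the condition of part 1 does not hold, then there exists a vector $b\in\mathbb{R}^m$ such that the minimum rank solution of $\mathcal{A}(X)=b$ has rank at most $r$ and is not equal to the minimum nuclear norm solution.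
   Context: For a matrix $X$, $\|X\|_*$ denotes the nuclear norm, i.e. the sum of the singular values of $X$. The null space of $\mathcal{A}$ is $\{Y:\mathcal{A}(Y)=0\}$. The minimum rank solution of $\mathcal{A}(X)=b$ is the optimal solution of minimizing $\operatorname{rank}(X)$ over all $X$ with $\mathcal{A}(X)=b$; the minimum nuclear norm solution is the optimal solution of minimizing $\|X\|_*$ over the same set. In part 2 the vector $b$ is existentially quantified and need not be the $b$ fixed at the start. *)

theory Defs
  imports "HOL-Analysis.Analysis"
begin

(* The real n1 x n2 matrices form the type real^'n2^'n1 (rows are indexed by 'n1).
   The singular values of X are the square roots of the eigenvalues of X^T X; the
   multiplicity of s is the dimension of the eigenspace of X^T X for s^2.  Since X^T X
   is n2 x n2, the value 0 may occur more often than in the convention that lists only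
   min(n1,n2) singular values; this does not affect their sum. *)

definition singular_values :: "real^'n2^'n1 \<Rightarrow> real set" where
  "singular_values X =
     {s. 0 \<le> s \<and> (\<exists>v. v \<noteq> 0 \<and> (transpose X ** X) *v v = s\<^sup>2 *\<^sub>R v)}"

definition singular_multiplicity :: "real^'n2^'n1 \<Rightarrow> real \<Rightarrow> nat" where
  "singular_multiplicity X s = dim {v. (transpose X ** X) *v v = s\<^sup>2 *\<^sub>R v}"

definition nuclear_norm :: "real^'n2^'n1 \<Rightarrow> real" where
  "nuclear_norm X = (\<Sum>s\<in>singular_values X. real (singular_multiplicity X s) * s)"

definition min_rank_solutions ::
    "(real^'n2^'n1 \<Rightarrow> real^'m) \<Rightarrow> real^'m \<Rightarrow> (real^'n2^'n1) set" where
  "min_rank_solutions A b = {X. is_arg_min rank (\<lambda>Z. A Z = b) X}"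

definition min_nuclear_solutions ::
    "(real^'n2^'n1 \<Rightarrow> real^'m) \<Rightarrow> real^'m \<Rightarrow> (real^'n2^'n1) set" where
  "min_nuclear_solutions A b = {X. is_arg_min nuclear_norm (\<lambda>Z. A Z = b) X}"

definition null_space_condition :: "(real^'n2^'n1 \<Rightarrow> real^'m) \<Rightarrow> nat \<Rightarrow> bool" where
  "null_space_condition A r \<longleftrightarrow>
     (\<forall>Y Y1 Y2. A Y = 0 \<and> Y = Y1 + Y2 \<and> rank Y1 = r \<and> rank Y2 > r
        \<longrightarrow> nuclear_norm Y1 < nuclear_norm Y2)"

end

(* Apart from linear algebra, the proof uses only that the nuclear norm is a norm.

   Part 1. A feasible Z of rank greater than r is handled by the decomposition X0 + (-Z) of
   X0 - Z.  A feasible Z of rank r would give a nonzero null vector of rank at most 2r, and every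
   such matrix has an explicit decomposition that violates the condition.

   Part 2. Suppose that for every b' of minimal rank at most r the minimum rank solutions are
   exactly the minimum nuclear norm solutions.  A violating decomposition Y1 + Y2 then yields a
   nonzero null vector of rank less than 2r; let N be one of least rank k.  If k = 2q, split
   N = P - Q with rank P = rank Q = q: both P and Q are minimum rank solutions for the same b', so
   their midpoint has minimal nuclear norm although its rank is k.  If k = 2p + 1, let T be the set
   of matrices X of rank p + 1 such that A X is attained at rank at most p.  T is closed among the
   matrices of rank p + 1 because A is injective on low rank.  It is also open: for X in T, the
   solution Z of lower rank has strictly smaller nuclear norm, so X + E is still beaten by Z + E for
   small E, hence is not a minimum rank solution.  The matrices of rank p + 1 form a connected set,
   but T contains a part of N and does not contain the first p + 1 terms of a rank factorization
   of X0. *)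

theory Submission
  imports Defs
begin

section \<open>Singular value decomposition and the nuclear norm\<close>

text \<open>A first-order condition: near \<open>t = 0\<close> the linear term dominates and changes
  sign with \<open>t\<close>. It is applied below to a maximizer on the unit sphere.\<close>

lemma linear_coeff_zero_if_quadratic_nonpos:
  fixes p q :: real
  assumes "\<And>t. 2 * t * p + t\<^sup>2 * q \<le> 0"
  shows "p = 0"
proof (rule ccontr)
  assume "p \<noteq> 0"
  \<comment> \<open>This scale gives \<open>\<bar>q\<bar> / D < 1\<close>, so the quadratic term at
    \<open>s = p / D\<close> cannot cancel the linear one.\<close>
  define D where "D = 1 + \<bar>q\<bar>"
  define s where "s = p / D"
  have "0 < D" by (simp add: D_def)
  have "- 2 * D < q" by (simp add: D_def)
  then have "0 < 2 + q / D"
    using \<open>0 < D\<close> by (simp add: field_simps)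
  moreover have "2 * s * p + s\<^sup>2 * q = p\<^sup>2 / D * (2 + q / D)"
    using \<open>0 < D\<close> by (simp add: s_def field_simps power2_eq_square)
  moreover have "0 < p\<^sup>2 / D"
    using \<open>p \<noteq> 0\<close> \<open>0 < D\<close> by (intro divide_pos_pos) auto
  ultimately have "0 < 2 * s * p + s\<^sup>2 * q"
    by (metis mult_pos_pos)
  then show False
    using assms[of s] by linarith
qed

text \<open>This yields the singular value decomposition without the spectral theorem. Induction on
  the dimension splits off a unit vector \<open>v\<close> of \<open>S\<close> maximizing
  \<open>norm (f v)\<close> and continues in the orthogonal complement of \<open>v\<close> in
  \<open>S\<close>.\<close>

lemma orthonormal_basis_orthogonal_images:
  fixes f :: "'a::euclidean_space \<Rightarrow> 'b::euclidean_space"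
  assumes f: "linear f" and "subspace S"
  shows "\<exists>B. finite B \<and> pairwise orthogonal B \<and> (\<forall>v\<in>B. norm v = 1) \<and> span B = S \<and>
             pairwise (\<lambda>v w. orthogonal (f v) (f w)) B"
  using \<open>subspace S\<close>
proof (induction "dim S" arbitrary: S rule: less_induct)
  case less
  interpret f: linear f by (rule f)
  show ?case
  proof (cases "S = {0}")
    case True
    then show ?thesis by (intro exI[of _ "{}"]) (auto simp: pairwise_def)
  next
    case False
    let ?K = "S \<inter> sphere 0 1"
    obtain y where "y \<in> S" "y \<noteq> 0"
      using False less.prems subspace_0 by blast
    then have "y /\<^sub>R norm y \<in> ?K"
      using less.prems by (simp add: subspace_scale)
    then have "?K \<noteq> {}" by blast
    moreover have "compact ?K"
      by (metis closed_subspace[OF less.prems] closed_Int_compact compact_sphere)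
    moreover have "continuous_on ?K (\<lambda>v. norm (f v))"
      by (intro continuous_intros linear_continuous_on linear_conv_bounded_linear[THEN iffD1] f)
    ultimately obtain v where "v \<in> ?K" and vmax: "\<And>u. u \<in> ?K \<Longrightarrow> norm (f u) \<le> norm (f v)"
      using continuous_attains_sup by metis
    then have vS: "v \<in> S" and v1: "norm v = 1" by auto
    have vle: "norm (f u) \<le> norm (f v) * norm u" if "u \<in> S" for u
    proof (cases "u = 0")
      case False
      then have "u /\<^sub>R norm u \<in> ?K"
        using that less.prems by (simp add: subspace_scale)
      from vmax[OF this] show ?thesis
        using False by (simp add: f.scale field_simps)
    qed (simp add: f.zero)
    \<comment> \<open>Maximality of \<open>v\<close>, tested on \<open>v + t *\<^sub>R w\<close>, is
      a quadratic inequality in \<open>t\<close> whose linear coefficient is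
      \<open>f v \<bullet> f w\<close>.\<close>
    have orth: "f v \<bullet> f w = 0" if w: "w \<in> S" "orthogonal v w" for w
    proof (rule linear_coeff_zero_if_quadratic_nonpos)
      fix t :: real
      have "v + t *\<^sub>R w \<in> S"
        using vS w less.prems by (simp add: subspace_add subspace_scale)
      then have le: "(norm (f (v + t *\<^sub>R w)))\<^sup>2 \<le> (norm (f v) * norm (v + t *\<^sub>R w))\<^sup>2"
        by (intro power_mono vle) auto
      have nv: "(norm (v + t *\<^sub>R w))\<^sup>2 = 1 + t\<^sup>2 * (w \<bullet> w)"
        using w v1 unfolding power2_norm_eq_inner
        by (simp add: inner_add_left inner_add_right orthogonal_def norm_eq_1 inner_commute
            power2_eq_square)
      have nf: "(norm (f (v + t *\<^sub>R w)))\<^sup>2 = f v \<bullet> f v + 2 * t * (f v \<bullet> f w) + t\<^sup>2 * (f w \<bullet> f w)"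
        unfolding power2_norm_eq_inner f.add f.scale
        by (simp add: inner_add_left inner_add_right inner_commute[of "f w" "f v"]
            power2_eq_square distrib_left)
      show "2 * t * (f v \<bullet> f w) + t\<^sup>2 * (f w \<bullet> f w - f v \<bullet> f v * (w \<bullet> w)) \<le> 0"
        using le unfolding power_mult_distrib nv nf
        by (simp add: power2_norm_eq_inner algebra_simps)
    qed
    define T where "T = {y \<in> S. \<forall>x \<in> span {v}. orthogonal x y}"
    have T_iff: "y \<in> T \<longleftrightarrow> y \<in> S \<and> orthogonal v y" for y
      unfolding T_def by (auto simp: span_singleton orthogonal_def)
    have T: "subspace T"
      using less.prems by (auto simp: subspace_def T_iff orthogonal_def inner_add_right)
    have "dim T + dim (span {v}) = dim S"
      unfolding T_def using vS less.prems
      by (intro dim_subspace_orthogonal_to_vectors) (auto simp: span_minimal)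
    moreover have "dim (span {v}) = 1"
      using v1 by (auto simp: dim_span dim_singleton)
    ultimately have "dim T < dim S" by linarith
    from less.hyps[OF this T] obtain B where B: "finite B" "pairwise orthogonal B"
      "\<forall>v\<in>B. norm v = 1" "span B = T" "pairwise (\<lambda>v w. orthogonal (f v) (f w)) B"
      by blast
    have BT: "u \<in> T" if "u \<in> B" for u
      using that B(4) span_base by blast
    have "span (insert v B) = S"
    proof
      show "span (insert v B) \<subseteq> S"
        using BT vS less.prems by (intro span_minimal) (auto simp: T_iff)
      show "S \<subseteq> span (insert v B)"
      proof
        fix x assume "x \<in> S"
        then have "x - (x \<bullet> v) *\<^sub>R v \<in> T"
          using vS v1 less.prems
          by (auto simp: T_iff orthogonal_def inner_diff_right norm_eq_1 inner_commute
              subspace_diff subspace_scale)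
        then have "x - (x \<bullet> v) *\<^sub>R v \<in> span (insert v B)"
          using B(4) span_mono[of B "insert v B"] by blast
        moreover have "(x \<bullet> v) *\<^sub>R v \<in> span (insert v B)"
          by (simp add: span_base span_scale)
        ultimately show "x \<in> span (insert v B)"
          using span_add by fastforce
      qed
    qed
    moreover have "orthogonal v u \<and> orthogonal (f v) (f u)" if "u \<in> B" for u
      using BT[OF that] orth by (auto simp: T_iff orthogonal_def)
    ultimately show ?thesis
      using B v1 
      by (intro exI[of _ "insert v B"]) (auto simp: pairwise_insert orthogonal_commute)
  qed
qed

text \<open>A complete orthonormal system of right singular vectors. The lengths of the images are
  the singular values with multiplicity, and vectors of the kernel are included.\<close>

definition right_singular_basis :: "real^'n2^'n1 \<Rightarrow> (real^'n2) set \<Rightarrow> bool" where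
  "right_singular_basis X B \<longleftrightarrow> finite B \<and> pairwise orthogonal B \<and> (\<forall>v\<in>B. norm v = 1) \<and>
     span B = UNIV \<and> pairwise (\<lambda>v w. orthogonal (X *v v) (X *v w)) B"

lemma ex_right_singular_basis: "\<exists>B. right_singular_basis X B"
  unfolding right_singular_basis_def
  using orthonormal_basis_orthogonal_images[of "(*v) X" UNIV] by auto

lemma right_singular_basis_expand:
  assumes "right_singular_basis X B"
  shows "(\<Sum>v\<in>B. (x \<bullet> v) *\<^sub>R v) = x"
  using assms by (intro orthonormal_basis_expand) (auto simp: right_singular_basis_def)

lemma right_singular_basis_inner:
  assumes "right_singular_basis X B" "v \<in> B" "w \<in> B"
  shows "v \<bullet> w = (if v = w then 1 else 0)"
  using assms by (auto simp: right_singular_basis_def pairwise_def orthogonal_def norm_eq_1)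

text \<open>Tested against \<open>w\<close> in \<open>B\<close>, the left side gives
  \<open>(X *v v) \<bullet> (X *v w)\<close>, which vanishes unless \<open>w = v\<close>.\<close>

lemma right_singular_basis_eigen:
  assumes B: "right_singular_basis X B" and v: "v \<in> B"
  shows "(transpose X ** X) *v v = (norm (X *v v))\<^sup>2 *\<^sub>R v"
proof -
  have "((transpose X ** X) *v v) \<bullet> w = (if w = v then (norm (X *v v))\<^sup>2 else 0)" if "w \<in> B" for w
  proof -
    have "((transpose X ** X) *v v) \<bullet> w = (X *v v) \<bullet> (X *v w)"
      by (metis dot_lmul_matrix inner_commute matrix_vector_mul_assoc vector_transpose_matrix transpose_transpose)
    then show ?thesis
      using B v that by (auto simp: right_singular_basis_def pairwise_def orthogonal_def power2_norm_eq_inner)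
  qed
  then have "(\<Sum>w\<in>B. (((transpose X ** X) *v v) \<bullet> w) *\<^sub>R w)
      = (\<Sum>w\<in>B. if w = v then (norm (X *v v))\<^sup>2 *\<^sub>R v else 0)"
    by (intro sum.cong) auto
  then show ?thesis
    using B v by (simp add: right_singular_basis_expand[OF B] right_singular_basis_def)
qed

text \<open>Since the matrix is symmetric, an eigenvector for \<open>c\<close> is orthogonal to
  every basis vector with another eigenvalue, so its expansion in \<open>B\<close> only uses those
  with eigenvalue \<open>c\<close>.\<close>

lemma right_singular_basis_eigenspace:
  assumes B: "right_singular_basis X B"
  shows "{v. (transpose X ** X) *v v = c *\<^sub>R v} = span {v \<in> B. (norm (X *v v))\<^sup>2 = c}" (is "?E = span ?C")
proof
  show "span ?C \<subseteq> ?E"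
  proof (rule span_minimal)
    show "subspace ?E"
      by (auto simp: subspace_def matrix_vector_right_distrib matrix_vector_mult_scaleR algebra_simps)
    show "?C \<subseteq> ?E"
      using right_singular_basis_eigen[OF B] by auto
  qed
  show "?E \<subseteq> span ?C"
  proof
    fix x assume "x \<in> ?E"
    then have x: "(transpose X ** X) *v x = c *\<^sub>R x" by simp
    have "(x \<bullet> v) *\<^sub>R v \<in> span ?C" if v: "v \<in> B" for v
    proof (cases "(norm (X *v v))\<^sup>2 = c")
      case True
      then show ?thesis using v by (auto intro: span_base span_scale)
    next
      case False
      have "((transpose X ** X) *v x) \<bullet> v = x \<bullet> ((transpose X ** X) *v v)"
        by (metis dot_lmul_matrix inner_commute matrix_transpose_mul transpose_transpose vector_transpose_matrix)
      then have "c * (x \<bullet> v) = (norm (X *v v))\<^sup>2 * (x \<bullet> v)"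
        by (simp add: x right_singular_basis_eigen[OF B v])
      then show ?thesis using False by (simp add: span_zero)
    qed
    then have "(\<Sum>v\<in>B. (x \<bullet> v) *\<^sub>R v) \<in> span ?C"
      by (intro span_sum) auto
    then show "x \<in> span ?C"
      by (simp add: right_singular_basis_expand[OF B])
  qed
qed

text \<open>Grouping \<open>B\<close> by the value of \<open>norm (X *v v)\<close> turns the sum
  into the definition: the group of \<open>s\<close> is a basis of the eigenspace for
  \<open>s\<^sup>2\<close>, so its size is the multiplicity of \<open>s\<close>.\<close>

lemma nuclear_norm_eq_sum:
  assumes B: "right_singular_basis X B"
  shows "nuclear_norm X = (\<Sum>v\<in>B. norm (X *v v))"
proof -
  have fin: "finite B" using B by (simp add: right_singular_basis_def)
  let ?C = "\<lambda>s. {v \<in> B. norm (X *v v) = s}"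
  have ind: "independent D" if "D \<subseteq> B" for D
  proof (rule pairwise_orthogonal_independent)
    show "pairwise orthogonal D"
      using B that by (auto simp: right_singular_basis_def intro: pairwise_subset)
    show "0 \<notin> D"
      using B that by (force simp: right_singular_basis_def)
  qed
  have C: "{v. (transpose X ** X) *v v = s\<^sup>2 *\<^sub>R v} = span (?C s)" if "0 \<le> s" for s
  proof -
    have "(norm (X *v v))\<^sup>2 = s\<^sup>2 \<longleftrightarrow> norm (X *v v) = s" for v
      using that by (auto simp: power2_eq_iff_nonneg)
    then show ?thesis
      by (simp add: right_singular_basis_eigenspace[OF B])
  qed
  have mult: "singular_multiplicity X s = card (?C s)" if "0 \<le> s" for s
    unfolding singular_multiplicity_def C[OF that]
    by (subst dim_span, rule dim_eq_card_independent, rule ind) auto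
  have vals: "singular_values X = (\<lambda>v. norm (X *v v)) ` B"
  proof (intro equalityI subsetI)
    fix s assume "s \<in> singular_values X"
    then obtain v where "0 \<le> s" "v \<noteq> 0" "v \<in> {v. (transpose X ** X) *v v = s\<^sup>2 *\<^sub>R v}"
      unfolding singular_values_def by blast
    then have "v \<in> span (?C s)" by (simp only: C)
    then have "?C s \<noteq> {}"
      using \<open>v \<noteq> 0\<close> by (metis singletonD span_empty)
    then show "s \<in> (\<lambda>v. norm (X *v v)) ` B" by blast
  next
    fix s assume "s \<in> (\<lambda>v. norm (X *v v)) ` B"
    then obtain v where v: "v \<in> B" "s = norm (X *v v)" by blast
    then have "v \<noteq> 0" using B by (force simp: right_singular_basis_def)
    then show "s \<in> singular_values X"
      unfolding singular_values_def using right_singular_basis_eigen[OF B v(1)] v(2) by auto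
  qed
  have "nuclear_norm X = (\<Sum>s\<in>(\<lambda>v. norm (X *v v)) ` B. \<Sum>v\<in>?C s. norm (X *v v))"
    unfolding nuclear_norm_def vals by (rule sum.cong) (auto simp: mult)
  also have "\<dots> = (\<Sum>v\<in>B. norm (X *v v))"
    by (rule sum.image_gen[OF fin, symmetric])
  finally show ?thesis .
qed

section \<open>The nuclear norm is a norm\<close>

lemma right_singular_basis_scaleR:
  "right_singular_basis X B \<Longrightarrow> right_singular_basis (c *\<^sub>R X) B"
  by (auto simp: right_singular_basis_def pairwise_def scaleR_matrix_vector_assoc[symmetric] orthogonal_def)

lemma nuclear_norm_scaleR: "nuclear_norm (c *\<^sub>R X) = \<bar>c\<bar> * nuclear_norm X"
proof -
  obtain B where B: "right_singular_basis X B" using ex_right_singular_basis by blast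
  show ?thesis
    by (simp add: nuclear_norm_eq_sum[OF B] nuclear_norm_eq_sum[OF right_singular_basis_scaleR[OF B]]
        scaleR_matrix_vector_assoc[symmetric] sum_distrib_left)
qed

lemma nuclear_norm_pos: 
  assumes "X \<noteq> 0" shows "0 < nuclear_norm X"
proof -
  obtain B where B: "right_singular_basis X B" using ex_right_singular_basis by blast
  have "nuclear_norm X \<noteq> 0"
  proof
    assume "nuclear_norm X = 0"
    then have "\<forall>v\<in>B. X *v v = 0"
      using B by (simp add: nuclear_norm_eq_sum[OF B] sum_nonneg_eq_0_iff right_singular_basis_def)
    then have "X *v x = 0" for x
      using linear_eq_0_on_span[of "(*v) X" B x] B by (auto simp: right_singular_basis_def)
    then show False
      using assms by (simp add: matrix_eq)
  qed
  then show ?thesis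
    by (simp add: nuclear_norm_eq_sum[OF B] less_le sum_nonneg)
qed

text \<open>Both sides are the trace of the adjoint of \<open>f\<close> composed with
  \<open>g\<close>, which does not depend on the orthonormal basis.\<close>

lemma sum_inner_images_eq:
  assumes B: "right_singular_basis X B" and C: "right_singular_basis Y C" and "linear f" "linear g"
  shows "(\<Sum>v\<in>B. f v \<bullet> g v) = (\<Sum>w\<in>C. f w \<bullet> g w)"
proof -
  interpret f: linear f by fact
  interpret g: linear g by fact
  have "(\<Sum>v\<in>B. f v \<bullet> g v) = (\<Sum>v\<in>B. f (\<Sum>w\<in>C. (v \<bullet> w) *\<^sub>R w) \<bullet> g v)"
    by (simp add: right_singular_basis_expand[OF C])
  also have "\<dots> = (\<Sum>v\<in>B. \<Sum>w\<in>C. (v \<bullet> w) * (f w \<bullet> g v))"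
    by (simp add: f.sum f.scale inner_sum_left)
  also have "\<dots> = (\<Sum>w\<in>C. f w \<bullet> g (\<Sum>v\<in>B. (w \<bullet> v) *\<^sub>R v))"
    by (subst sum.swap) (simp add: g.sum g.scale inner_sum_right inner_commute)
  finally show ?thesis
    by (simp add: right_singular_basis_expand[OF B])
qed

text \<open>The contraction \<open>Q\<close> sending each right singular vector of \<open>X + Y\<close> to the corresponding
  left singular vector attains \<open>nuclear_norm Z = max tr (Q\<^sup>T Z)\<close> at \<open>Z = X + Y\<close>.\<close>

lemma nuclear_norm_triangle: "nuclear_norm (X + Y) \<le> nuclear_norm X + nuclear_norm Y"
proof -
  obtain B where B: "right_singular_basis (X + Y) B" using ex_right_singular_basis by blast
  have fin: "finite B" using B by (simp add: right_singular_basis_def)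
  \<comment> \<open>If \<open>(X + Y) *v v = 0\<close>, division by zero makes
    \<open>u v = 0\<close>, so \<open>Q\<close> is a partial isometry.\<close>
  define u where "u v = (X + Y) *v v /\<^sub>R norm ((X + Y) *v v)" for v
  define Q where "Q x = (\<Sum>v\<in>B. (x \<bullet> v) *\<^sub>R u v)" for x
  have "linear Q"
    unfolding Q_def
    by (rule linearI) (simp_all add: inner_add_left scaleR_add_left sum.distrib scaleR_sum_right)
  have Qv: "Q v = u v" if "v \<in> B" for v
  proof -
    have "Q v = (\<Sum>w\<in>B. if w = v then u v else 0)"
      unfolding Q_def using right_singular_basis_inner[OF B that] by (intro sum.cong) auto
    then show ?thesis using that fin by simp
  qed
  have contr: "norm (Q x) \<le> norm x" for x
  proof (rule power2_le_imp_le)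
    have 1: "(norm (Q x))\<^sup>2 = (\<Sum>v\<in>B. (norm ((x \<bullet> v) *\<^sub>R u v))\<^sup>2)"
      unfolding Q_def using B
      by (intro norm_sum_Pythagorean fin)
        (auto simp: u_def right_singular_basis_def pairwise_def orthogonal_def)
    have 2: "(norm (\<Sum>v\<in>B. (x \<bullet> v) *\<^sub>R v))\<^sup>2 = (\<Sum>v\<in>B. (norm ((x \<bullet> v) *\<^sub>R v))\<^sup>2)"
      using B by (intro norm_sum_Pythagorean fin)
        (auto simp: right_singular_basis_def pairwise_def orthogonal_def)
    have "(norm (Q x))\<^sup>2 \<le> (\<Sum>v\<in>B. (norm ((x \<bullet> v) *\<^sub>R v))\<^sup>2)"
      unfolding 1
    proof (intro sum_mono power_mono)
      fix v assume "v \<in> B"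
      moreover have "norm (u v) \<le> 1" by (cases "(X + Y) *v v = 0") (simp_all add: u_def)
      ultimately show "norm ((x \<bullet> v) *\<^sub>R u v) \<le> norm ((x \<bullet> v) *\<^sub>R v)"
        using B by (simp add: right_singular_basis_def mult_left_le)
    qed auto
    then show "(norm (Q x))\<^sup>2 \<le> (norm x)\<^sup>2"
      unfolding 2[symmetric] right_singular_basis_expand[OF B] .
  qed auto
  \<comment> \<open>Basis independence of the trace allows a right singular basis of
    \<open>Z\<close> here. There each term is at most \<open>norm (Z *v w)\<close>, as
    \<open>Q\<close> is a contraction.\<close>
  have bound: "(\<Sum>v\<in>B. Q v \<bullet> (Z *v v)) \<le> nuclear_norm Z" for Z
  proof -
    obtain C where C: "right_singular_basis Z C" using ex_right_singular_basis by blast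
    have "(\<Sum>v\<in>B. Q v \<bullet> (Z *v v)) = (\<Sum>w\<in>C. Q w \<bullet> (Z *v w))"
      by (rule sum_inner_images_eq[OF B C \<open>linear Q\<close>]) auto
    also have "\<dots> \<le> (\<Sum>w\<in>C. norm (Z *v w))"
    proof (rule sum_mono)
      fix w assume "w \<in> C"
      then have "norm (Q w) \<le> 1" using contr[of w] C by (auto simp: right_singular_basis_def)
      then show "Q w \<bullet> (Z *v w) \<le> norm (Z *v w)"
        by (meson mult_left_le_one_le norm_cauchy_schwarz norm_ge_zero order_trans)
    qed
    finally show ?thesis by (simp add: nuclear_norm_eq_sum[OF C])
  qed
  have "nuclear_norm (X + Y) = (\<Sum>v\<in>B. Q v \<bullet> ((X + Y) *v v))"
    unfolding nuclear_norm_eq_sum[OF B]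
  proof (rule sum.cong)
    fix v assume "v \<in> B"
    then show "norm ((X + Y) *v v) = Q v \<bullet> ((X + Y) *v v)"
      by (simp add: Qv u_def power2_norm_eq_inner[symmetric] power2_eq_square field_simps)
  qed simp
  also have "\<dots> = (\<Sum>v\<in>B. Q v \<bullet> (X *v v)) + (\<Sum>v\<in>B. Q v \<bullet> (Y *v v))"
    by (simp add: matrix_vector_mult_add_rdistrib inner_add_right sum.distrib)
  also have "\<dots> \<le> nuclear_norm X + nuclear_norm Y"
    by (intro add_mono bound)
  finally show ?thesis .
qed

lemma nuclear_norm_0 [simp]: "nuclear_norm 0 = 0"
  using nuclear_norm_scaleR[of 0 0] by simp

lemma nuclear_norm_minus [simp]: "nuclear_norm (- X) = nuclear_norm X"
  using nuclear_norm_scaleR[of "-1" X] by simp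

lemma nuclear_norm_nonneg: "0 \<le> nuclear_norm X"
  using nuclear_norm_pos[of X] by (cases "X = 0") auto

text \<open>Homogeneity and the triangle inequality give convexity, and a convex function on a whole
  Euclidean space is continuous.\<close>

lemma continuous_on_nuclear_norm: "continuous_on UNIV nuclear_norm"
proof (rule convex_on_continuous)
  show "convex_on UNIV (nuclear_norm :: real^'n2^'n1 \<Rightarrow> real)"
  proof (rule convex_onI)
    fix t :: real and X Y :: "real^'n2^'n1"
    assume "0 < t" "t < 1"
    then show "nuclear_norm ((1 - t) *\<^sub>R X + t *\<^sub>R Y) \<le> (1 - t) * nuclear_norm X + t * nuclear_norm Y"
      using nuclear_norm_triangle[of "(1 - t) *\<^sub>R X" "t *\<^sub>R Y"] by (simp add: nuclear_norm_scaleR)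
  qed auto
qed auto

section \<open>Rank factorizations\<close>

definition outer :: "real^'n1 \<Rightarrow> real^'n2 \<Rightarrow> real^'n2^'n1" where
  "outer a b = (\<chi> i j. a $ i * b $ j)"

lemma outer_mult_vec: "outer a b *v x = (b \<bullet> x) *\<^sub>R a"
  by (simp add: outer_def matrix_vector_mult_def inner_vec_def vec_eq_iff sum_distrib_left
      mult.commute mult.left_commute)

lemma outer_scaleR_left: "outer (c *\<^sub>R a) b = c *\<^sub>R outer a b"
  and outer_add_left: "outer (a + a') b = outer a b + outer a' b"
  and outer_add_right: "outer a (b + b') = outer a b + outer a b'"
  and outer_scaleR_right: "outer a (c *\<^sub>R b) = c *\<^sub>R outer a b"
  by (simp_all add: outer_def vec_eq_iff algebra_simps)

lemma continuous_on_outer [continuous_intros]: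
  assumes "continuous_on S f" "continuous_on S g"
  shows "continuous_on S (\<lambda>x. outer (f x) (g x))"
  unfolding outer_def by (intro continuous_intros assms continuous_on_vec_lambda)

lemma sum_outer_mult_vec: "(\<Sum>i\<in>I. outer (a i) (b i)) *v x = (\<Sum>i\<in>I. (b i \<bullet> x) *\<^sub>R a i)"
  by (induction I rule: infinite_finite_induct)
    (simp_all add: matrix_vector_mult_add_rdistrib outer_mult_vec)

text \<open>Indexed families instead of sets keep the left and right factors of a sum of outer
  products paired by a common index, and they rule out repetitions.\<close>

definition independent_family :: "'i set \<Rightarrow> ('i \<Rightarrow> 'a::real_vector) \<Rightarrow> bool" where
  "independent_family I a \<longleftrightarrow> finite I \<and> (\<forall>c. (\<Sum>i\<in>I. c i *\<^sub>R a i) = 0 \<longrightarrow> (\<forall>i\<in>I. c i = 0))"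

lemma independent_familyD:
  "independent_family I a \<Longrightarrow> (\<Sum>i\<in>I. c i *\<^sub>R a i) = 0 \<Longrightarrow> i \<in> I \<Longrightarrow> c i = 0"
  by (auto simp: independent_family_def)

lemma independent_family_cong:
  "(\<And>i. i \<in> I \<Longrightarrow> a i = b i) \<Longrightarrow> independent_family I a \<longleftrightarrow> independent_family I b"
  by (simp add: independent_family_def cong: sum.cong)

lemma independent_family_subset:
  assumes a: "independent_family I a" and "J \<subseteq> I"
  shows "independent_family J a"
proof -
  have fin: "finite I" using a by (simp add: independent_family_def)
  have "c j = 0" if "(\<Sum>i\<in>J. c i *\<^sub>R a i) = 0" "j \<in> J" for c j
  proof -
    have "(\<Sum>i\<in>I. (if i \<in> J then c i else 0) *\<^sub>R a i) = (\<Sum>i\<in>J. c i *\<^sub>R a i)"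
      using \<open>J \<subseteq> I\<close> fin by (intro sum.mono_neutral_cong_right) auto
    then show ?thesis
      using independent_familyD[OF a, of "\<lambda>i. if i \<in> J then c i else 0" j] that \<open>J \<subseteq> I\<close> by auto
  qed
  then show ?thesis
    using fin \<open>J \<subseteq> I\<close> by (auto simp: independent_family_def intro: finite_subset)
qed

lemma independent_family_scaleR:
  assumes a: "independent_family I a" and c: "\<And>i. i \<in> I \<Longrightarrow> c i \<noteq> 0"
  shows "independent_family I (\<lambda>i. c i *\<^sub>R a i)"
proof -
  have "d i = 0" if "(\<Sum>i\<in>I. d i *\<^sub>R c i *\<^sub>R a i) = 0" "i \<in> I" for d i
    using independent_familyD[OF a, of "\<lambda>i. d i * c i" i] that c by auto
  then show ?thesis using a by (simp add: independent_family_def)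
qed

lemma independent_family_inj:
  assumes a: "independent_family I a"
  shows "inj_on a I"
proof (rule inj_onI, rule ccontr)
  fix i j assume ij: "i \<in> I" "j \<in> I" "a i = a j" "i \<noteq> j"
  have "(\<Sum>k\<in>I. ((if k = i then 1 else 0) - (if k = j then 1 else 0)) *\<^sub>R a k) = a i - a j"
    using a ij by (simp add: scaleR_diff_left sum_subtractf if_distrib[of "\<lambda>x. x *\<^sub>R _"]
        independent_family_def cong: if_cong)
  then show False
    using independent_familyD[OF a, of "\<lambda>k. (if k = i then 1 else 0) - (if k = j then 1 else 0)" i] ij
    by auto
qed

lemma independent_family_independent:
  assumes a: "independent_family I a"
  shows "independent (a ` I)"
proof (rule independent_if_scalars_zero)
  show "finite (a ` I)" using a by (simp add: independent_family_def)
  fix f x assume "(\<Sum>x\<in>a ` I. f x *\<^sub>R x) = 0" "x \<in> a ` I"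
  then show "f x = 0"
    using independent_familyD[OF a, of "\<lambda>i. f (a i)"]
    by (auto simp: sum.reindex[OF independent_family_inj[OF a]])
qed

lemma dim_independent_family:
  fixes a :: "'i \<Rightarrow> 'a::euclidean_space"
  assumes "independent_family I a"
  shows "dim (span (a ` I)) = card I"
  using dim_eq_card_independent[OF independent_family_independent[OF assms]]
  by (simp add: card_image[OF independent_family_inj[OF assms]])

lemma independent_family_insert:
  assumes a: "independent_family I a" and x: "x \<notin> span (a ` I)" and "j \<notin> I"
  shows "independent_family (insert j I) (a(j := x))"
proof -
  have fin: "finite I" using a by (simp add: independent_family_def)
  have "c i = 0" if eq: "(\<Sum>i\<in>insert j I. c i *\<^sub>R (a(j := x)) i) = 0" and "i \<in> insert j I" for c i
  proof -
    have "(\<Sum>i\<in>I. c i *\<^sub>R (a(j := x)) i) = (\<Sum>i\<in>I. c i *\<^sub>R a i)"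
      using \<open>j \<notin> I\<close> by (intro sum.cong) auto
    with eq have eq': "c j *\<^sub>R x + (\<Sum>i\<in>I. c i *\<^sub>R a i) = 0"
      using fin \<open>j \<notin> I\<close> by simp
    have "c j = 0"
    proof (rule ccontr)
      assume "c j \<noteq> 0"
      have "c j *\<^sub>R x = - (\<Sum>i\<in>I. c i *\<^sub>R a i)"
        using eq' by (simp add: eq_neg_iff_add_eq_0)
      also have "\<dots> \<in> span (a ` I)"
        by (intro span_neg span_sum span_scale span_base) auto
      finally have "inverse (c j) *\<^sub>R c j *\<^sub>R x \<in> span (a ` I)"
        by (rule span_scale)
      then show False using x \<open>c j \<noteq> 0\<close> by simp
    qed
    then show ?thesis
      using independent_familyD[OF a, of c] eq' \<open>i \<in> insert j I\<close> by auto
  qed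
  then show ?thesis using fin by (auto simp: independent_family_def)
qed

text \<open>Let \<open>z\<close> be the component of \<open>a i\<close> orthogonal to the span of
  the other members. It is nonzero by independence, and
  \<open>a i \<bullet> z = z \<bullet> z\<close> fixes the scaling.\<close>

lemma independent_family_dual:
  fixes a :: "'i \<Rightarrow> 'a::euclidean_space"
  assumes a: "independent_family I a" and "i \<in> I"
  obtains d where "\<And>j. j \<in> I \<Longrightarrow> a j \<bullet> d = (if j = i then 1 else 0)"
proof -
  obtain y z where y: "y \<in> span (a ` (I - {i}))" and z: "\<And>w. w \<in> span (a ` (I - {i})) \<Longrightarrow> orthogonal z w"
    and yz: "a i = y + z"
    using orthogonal_subspace_decomp_exists[of "a ` (I - {i})" "a i"] by blast
  have "a ` (I - {i}) = a ` I - {a i}"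
    using independent_family_inj[OF a] \<open>i \<in> I\<close> by (auto simp: inj_on_def)
  then have "a i \<notin> span (a ` (I - {i}))"
    using independent_family_independent[OF a] \<open>i \<in> I\<close> by (auto simp: dependent_def)
  then have "z \<noteq> 0" using y yz by auto
  show thesis
  proof
    fix j assume "j \<in> I"
    show "a j \<bullet> (z /\<^sub>R (z \<bullet> z)) = (if j = i then 1 else 0)"
    proof (cases "j = i")
      case True
      then show ?thesis
        using z[OF y] \<open>z \<noteq> 0\<close> by (simp add: yz inner_add_left inner_add_right orthogonal_def inner_commute)
    next
      case False
      then have "orthogonal z (a j)" using \<open>j \<in> I\<close> by (intro z span_base) auto
      then show ?thesis using False by (simp add: orthogonal_def inner_commute)
    qed
  qed
qed

text \<open>The column space is the span of the \<open>a i\<close>: a vector dual to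
  \<open>b i\<close> is mapped to \<open>a i\<close>.\<close>

lemma rank_sum_outer:
  assumes a: "independent_family I a" and b: "independent_family I b"
  shows "rank (\<Sum>i\<in>I. outer (a i) (b i)) = card I"
proof -
  have fin: "finite I" using a by (simp add: independent_family_def)
  let ?X = "\<Sum>i\<in>I. outer (a i) (b i)"
  have "range ((*v) ?X) = span (a ` I)"
  proof
    show "range ((*v) ?X) \<subseteq> span (a ` I)"
      by (clarsimp simp: sum_outer_mult_vec) (intro span_sum span_scale span_base imageI)
    have "a i \<in> range ((*v) ?X)" if "i \<in> I" for i
    proof -
      obtain d where d: "\<And>j. j \<in> I \<Longrightarrow> b j \<bullet> d = (if j = i then 1 else 0)"
        using independent_family_dual[OF b \<open>i \<in> I\<close>] by blast
      have "?X *v d = (\<Sum>j\<in>I. if j = i then a i else 0)"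
        unfolding sum_outer_mult_vec by (intro sum.cong) (auto simp: d)
      also have "\<dots> = a i" using fin that by simp
      finally show ?thesis by (metis rangeI)
    qed
    moreover have "subspace (range ((*v) ?X))"
      by (simp add: linear_subspace_image)
    ultimately show "span (a ` I) \<subseteq> range ((*v) ?X)"
      by (intro span_minimal) auto
  qed
  then show ?thesis
    by (simp only: rank_dim_range dim_independent_family[OF a])
qed

text \<open>All later decompositions rescale the terms of one factorization, so that their ranks can
  be read off by counting nonzero coefficients.\<close>

lemma rank_sum_scaleR_outer:
  assumes a: "independent_family I a" and b: "independent_family I b"
  shows "rank (\<Sum>i\<in>I. c i *\<^sub>R outer (a i) (b i)) = card {i \<in> I. c i \<noteq> 0}"
proof -
  let ?J = "{i \<in> I. c i \<noteq> 0}"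
  have fin: "finite I" using a by (simp add: independent_family_def)
  have "(\<Sum>i\<in>I. c i *\<^sub>R outer (a i) (b i)) = (\<Sum>i\<in>?J. outer (c i *\<^sub>R a i) (b i))"
    using fin by (intro sum.mono_neutral_cong_right) (auto simp: outer_scaleR_left)
  moreover have "independent_family ?J (\<lambda>i. c i *\<^sub>R a i)" "independent_family ?J b"
    by (auto intro!: independent_family_scaleR independent_family_subset[OF a] independent_family_subset[OF b])
  ultimately show ?thesis
    by (simp add: rank_sum_outer)
qed

lemma independent_family_if_orthogonal:
  assumes "finite I" and orth: "\<And>i j. i \<in> I \<Longrightarrow> j \<in> I \<Longrightarrow> i \<noteq> j \<Longrightarrow> orthogonal (a i) (a j)"
    and nz: "\<And>i. i \<in> I \<Longrightarrow> a i \<noteq> 0"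
  shows "independent_family I a"
proof -
  have "c i = 0" if eq: "(\<Sum>i\<in>I. c i *\<^sub>R a i) = 0" and i: "i \<in> I" for c i
  proof -
    have "0 = (\<Sum>j\<in>I. c j *\<^sub>R a j) \<bullet> a i" by (simp add: eq)
    also have "\<dots> = (\<Sum>j\<in>I. if j = i then c i * (a i \<bullet> a i) else 0)"
      unfolding inner_sum_left using orth i by (intro sum.cong) (auto simp: orthogonal_def)
    also have "\<dots> = c i * (a i \<bullet> a i)" using i \<open>finite I\<close> by simp
    finally show ?thesis using nz[OF i] by simp
  qed
  then show ?thesis using \<open>finite I\<close> by (auto simp: independent_family_def)
qed

text \<open>Taken from the singular value decomposition: the right singular vectors outside the
  kernel and their images are both orthogonal families of nonzero vectors.\<close>

lemma rank_factorization:
  obtains a b where "independent_family {..<rank X} a" "independent_family {..<rank X} b"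
    "X = (\<Sum>i<rank X. outer (a i) (b i))"
proof -
  obtain B where B: "right_singular_basis X B" using ex_right_singular_basis by blast
  have fin: "finite B" using B by (simp add: right_singular_basis_def)
  define C where "C = {v \<in> B. X *v v \<noteq> 0}"
  have finC: "finite C" using fin by (simp add: C_def)
  have indX: "independent_family C (\<lambda>v. X *v v)"
    using B by (intro independent_family_if_orthogonal finC)
      (auto simp: C_def right_singular_basis_def pairwise_def)
  have ind: "independent_family C (\<lambda>v. v)"
    using B by (intro independent_family_if_orthogonal finC)
      (auto simp: C_def right_singular_basis_def pairwise_def)
  have X: "X = (\<Sum>v\<in>C. outer (X *v v) v)"
  proof -
    have "X *v x = (\<Sum>v\<in>C. outer (X *v v) v) *v x" for x
    proof -
      have "X *v x = X *v (\<Sum>v\<in>B. (x \<bullet> v) *\<^sub>R v)"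
        by (simp add: right_singular_basis_expand[OF B])
      also have "\<dots> = (\<Sum>v\<in>B. (v \<bullet> x) *\<^sub>R (X *v v))"
        by (simp add: linear_sum[OF matrix_vector_mul_linear] matrix_vector_mult_scaleR inner_commute)
      also have "\<dots> = (\<Sum>v\<in>C. (v \<bullet> x) *\<^sub>R (X *v v))"
        unfolding C_def using fin by (intro sum.mono_neutral_right) auto
      finally show ?thesis by (simp add: sum_outer_mult_vec)
    qed
    then show ?thesis by (rule matrix_eq[THEN iffD2, rule_format])
  qed
  have rk: "rank X = card C"
    by (subst X) (rule rank_sum_outer[OF indX ind])
  obtain h where h: "bij_betw h {..<card C} C"
    using ex_bij_betw_nat_finite[OF finC] by (auto simp: atLeast0LessThan)
  have reindex: "independent_family {..<card C} (\<lambda>i. f (h i))"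
    if "independent_family C f" for f :: "_ \<Rightarrow> 'x::real_vector"
  proof -
    have "c i = 0" if "(\<Sum>i<card C. c i *\<^sub>R f (h i)) = 0" "i < card C" for c i
    proof -
      let ?g = "the_inv_into {..<card C} h"
      have g: "?g (h i) = i" if "i < card C" for i
        using h that by (simp add: bij_betw_def the_inv_into_f_f)
      have "(\<Sum>v\<in>C. c (?g v) *\<^sub>R f v) = (\<Sum>i<card C. c (?g (h i)) *\<^sub>R f (h i))"
        by (rule sum.reindex_bij_betw[OF h, symmetric])
      also have "\<dots> = (\<Sum>i<card C. c i *\<^sub>R f (h i))"
        by (intro sum.cong) (auto simp: g)
      finally have "(\<Sum>v\<in>C. c (?g v) *\<^sub>R f v) = 0" using that by simp
      then have "c (?g (h i)) = 0"
        using independent_familyD[OF \<open>independent_family C f\<close>, of "\<lambda>v. c (?g v)" "h i"]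
          bij_betwE[OF h] that by auto
      then show ?thesis using g that by simp
    qed
    then show ?thesis by (auto simp: independent_family_def)
  qed
  show thesis
  proof
    show "independent_family {..<rank X} (\<lambda>i. X *v h i)" "independent_family {..<rank X} h"
      unfolding rk using reindex[OF indX] reindex[OF ind] by auto
    show "X = (\<Sum>i<rank X. outer (X *v h i) (h i))"
      unfolding rk by (subst X) (rule sum.reindex_bij_betw[OF h, symmetric])
  qed
qed

section \<open>Rank inequalities and lower semicontinuity of the rank\<close>

lemma rank_scaleR:
  fixes X :: "real^'n2^'n1"
  assumes "c \<noteq> 0" shows "rank (c *\<^sub>R X) = rank X"
proof -
  obtain a b where ab: "independent_family {..<rank X} a" "independent_family {..<rank X} b"
    and X: "X = (\<Sum>i<rank X. outer (a i) (b i))"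
    by (rule rank_factorization)
  have "c *\<^sub>R X = (\<Sum>i<rank X. c *\<^sub>R outer (a i) (b i))"
    by (subst X) (simp add: scaleR_sum_right)
  then show ?thesis
    using rank_sum_scaleR_outer[OF ab, of "\<lambda>_. c"] assms by simp
qed

lemma rank_minus [simp]: "rank (- X) = rank (X :: real^'n2^'n1)"
  using rank_scaleR[of "-1" X] by simp

lemma rank_add_le: "rank (X + Y) \<le> rank X + rank (Y :: real^'n2^'n1)"
proof -
  let ?S = "{x + y |x y. x \<in> range ((*v) X) \<and> y \<in> range ((*v) Y)}"
  have "range ((*v) (X + Y)) \<subseteq> ?S"
    by (auto simp: matrix_vector_mult_add_rdistrib)
  then have "rank (X + Y) \<le> dim ?S"
    unfolding rank_dim_range by (rule dim_subset)
  also have "\<dots> \<le> rank X + rank Y"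
    using dim_sums_Int[of "range ((*v) X)" "range ((*v) Y)"]
    by (simp add: rank_dim_range linear_subspace_image)
  finally show ?thesis .
qed

lemma rank_diff_le: "rank (X - Y) \<le> rank X + rank (Y :: real^'n2^'n1)"
  using rank_add_le[of X "- Y"] by simp

text \<open>On its row space, \<open>X\<close> is injective and hence bounded below by some
  \<open>e > 0\<close>. A perturbation of operator norm less than \<open>e\<close> stays injective
  there, so the rank cannot drop.\<close>

lemma closed_rank_le: "closed {X :: real^'n2^'n1. rank X \<le> p}"
proof -
  have "\<exists>e>0. \<forall>Y. dist Y X < e \<longrightarrow> p < rank Y" if "p < rank X" for X :: "real^'n2^'n1"
  proof -
    obtain a b where ab: "independent_family {..<rank X} a" "independent_family {..<rank X} b"
      and X: "X = (\<Sum>i<rank X. outer (a i) (b i))"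
      by (rule rank_factorization)
    let ?S = "span (b ` {..<rank X})"
    have "x = 0" if "x \<in> ?S" "X *v x = 0" for x
    proof -
      have "(\<Sum>i<rank X. (b i \<bullet> x) *\<^sub>R a i) = 0"
        using that(2) by (subst (asm) X) (simp add: sum_outer_mult_vec)
      then have "\<And>i. i < rank X \<Longrightarrow> orthogonal x (b i)"
        using independent_familyD[OF ab(1), of "\<lambda>i. b i \<bullet> x"]
        by (auto simp: orthogonal_def inner_commute)
      then have "orthogonal x x"
        by (intro orthogonal_to_span[OF that(1)]) auto
      then show ?thesis by (simp add: orthogonal_self)
    qed
    then have "\<exists>e>0. \<forall>x\<in>?S. norm (X *v x) \<ge> e * norm x"
      by (intro injective_imp_isometric) (auto simp: closed_subspace)
    then obtain e where "0 < e" and e: "\<And>x. x \<in> ?S \<Longrightarrow> e * norm x \<le> norm (X *v x)"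
      by auto
    define K where "K = real CARD('n1) * real CARD('n2)"
    have "0 < K" by (simp add: K_def)
    have K: "onorm ((*v) Y) \<le> K * norm Y" for Y :: "real^'n2^'n1"
      unfolding K_def
    proof (rule onorm_le_matrix_component)
      show "\<bar>Y $ i $ j\<bar> \<le> norm Y" for i j
        using component_le_norm_cart[of "Y $ i" j] Finite_Cartesian_Product.norm_nth_le[of Y i] by simp
    qed
    have "p < rank Y" if "dist Y X < e / K" for Y
    proof -
      have "K * norm (Y - X) < e"
        using that \<open>0 < K\<close> by (simp add: dist_norm field_simps)
      then have lt: "onorm ((*v) (Y - X)) < e" using K[of "Y - X"] by linarith
      have "x = 0" if x: "x \<in> ?S" "Y *v x = 0" for x
      proof (rule ccontr)
        assume "x \<noteq> 0"
        have "e * norm x \<le> norm (X *v x)" by (rule e[OF x(1)])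
        also have "\<dots> = norm ((Y - X) *v x)"
          using x(2) by (simp add: matrix_vector_mult_diff_rdistrib)
        also have "\<dots> \<le> onorm ((*v) (Y - X)) * norm x"
          by (rule onorm) auto
        also have "\<dots> < e * norm x" using lt \<open>x \<noteq> 0\<close> by simp
        finally show False by simp
      qed
      then have "inj_on ((*v) Y) (span ?S)"
        unfolding span_span by (subst linear_inj_on_iff_eq_0) auto
      then have "dim ((*v) Y ` ?S) = dim ?S"
        by (intro dim_image_eq) auto
      moreover have "dim ((*v) Y ` ?S) \<le> rank Y"
        unfolding rank_dim_range by (intro dim_subset) auto
      ultimately show ?thesis
        using dim_independent_family[OF ab(2)] \<open>p < rank X\<close> by simp
    qed
    then show ?thesis using \<open>0 < e\<close> \<open>0 < K\<close> by (intro exI[of _ "e / K"]) auto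
  qed
  then have "open {X :: real^'n2^'n1. p < rank X}"
    unfolding open_dist by blast
  then show ?thesis
    by (simp add: closed_def Compl_eq not_le)
qed

section \<open>Connectedness of the set of matrices of fixed rank\<close>

lemma ex_notin_two_subspaces:
  assumes S: "subspace S" "S \<noteq> UNIV" and T: "subspace T" "T \<noteq> UNIV"
  shows "\<exists>x. x \<notin> S \<and> x \<notin> T"
proof (rule ccontr)
  assume "\<not> ?thesis"
  then have cover: "\<And>x. x \<in> S \<or> x \<in> T" by blast
  obtain s t where st: "s \<notin> S" "t \<notin> T" using S T by blast
  then have "s \<in> T" "t \<in> S" using cover by blast+
  then have "s + t \<notin> T" "s + t \<notin> S"
    using st subspace_diff[OF T(1), of "s + t" s] subspace_diff[OF S(1), of "s + t" t] by auto
  then show False using cover by blast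
qed

text \<open>Both families grow by the same vector, chosen outside both spans. While the dimension is
  not exhausted such a vector exists, because two proper subspaces do not cover the space.\<close>

lemma ex_common_extension:
  fixes a c :: "nat \<Rightarrow> 'a::euclidean_space"
  assumes a: "independent_family {..<m} a" and c: "independent_family {..<m} c"
    and "m + j \<le> DIM('a)"
  shows "\<exists>h. independent_family {..<m + j} (\<lambda>i. if i < m then a i else h i) \<and>
             independent_family {..<m + j} (\<lambda>i. if i < m then c i else h i)"
  using \<open>m + j \<le> DIM('a)\<close>
proof (induction j)
  case 0
  have "independent_family {..<m} (\<lambda>i. if i < m then a i else 0)"
    using a by (subst independent_family_cong[of _ _ a]) auto
  moreover have "independent_family {..<m} (\<lambda>i. if i < m then c i else 0)"
    using c by (subst independent_family_cong[of _ _ c]) auto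
  ultimately show ?case by auto
next
  case (Suc j)
  then obtain h where h: "independent_family {..<m + j} (\<lambda>i. if i < m then a i else h i)"
    "independent_family {..<m + j} (\<lambda>i. if i < m then c i else h i)"
    by auto
  have proper: "span (f ` {..<m + j}) \<noteq> UNIV" if "independent_family {..<m + j} f" for f :: "nat \<Rightarrow> 'a"
  proof
    assume eq: "span (f ` {..<m + j}) = UNIV"
    from dim_independent_family[OF that] show False
      unfolding eq using Suc.prems by simp
  qed
  obtain x where x: "x \<notin> span ((\<lambda>i. if i < m then a i else h i) ` {..<m + j})"
    "x \<notin> span ((\<lambda>i. if i < m then c i else h i) ` {..<m + j})"
    using ex_notin_two_subspaces[OF subspace_span proper[OF h(1)] subspace_span proper[OF h(2)]]
    by blast
  have upd: "(\<lambda>i. if i < m then f i else h i)(m + j := x) = (\<lambda>i. if i < m then f i else (h(m + j := x)) i)"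
    for f :: "nat \<Rightarrow> 'a"
    by auto
  have "insert (m + j) {..<m + j} = {..<m + Suc j}" by auto
  then show ?case
    using independent_family_insert[OF h(1) x(1), of "m + j"]
      independent_family_insert[OF h(2) x(2), of "m + j"]
    unfolding upd by (intro exI[of _ "h(m + j := x)"]) simp
qed

text \<open>A relation with coefficients \<open>c i\<close> becomes a relation of the joint family
  with coefficients \<open>(1 - t) * c i\<close> and \<open>t * c i\<close>, and
  \<open>1 - t\<close> and \<open>t\<close> are not both zero.\<close>

lemma independent_family_segment:
  fixes a h :: "nat \<Rightarrow> 'a::real_vector"
  assumes ind: "independent_family {..<m + m} (\<lambda>i. if i < m then a i else h i)"
  shows "independent_family {..<m} (\<lambda>i. (1 - t) *\<^sub>R a i + t *\<^sub>R h (m + i))"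
proof -
  have split: "(\<Sum>i<m + n. f i) = (\<Sum>i<m. f i) + (\<Sum>i<n. f (m + i))" for f :: "nat \<Rightarrow> 'a" and n
    by (induction n) (auto simp: add.assoc)
  have "c i = 0" if eq: "(\<Sum>i<m. c i *\<^sub>R ((1 - t) *\<^sub>R a i + t *\<^sub>R h (m + i))) = 0" and "i < m" for c i
  proof -
    define d where "d i = (if i < m then (1 - t) * c i else t * c (i - m))" for i
    have "(\<Sum>i<m + m. d i *\<^sub>R (if i < m then a i else h i))
        = (\<Sum>i<m. c i *\<^sub>R ((1 - t) *\<^sub>R a i + t *\<^sub>R h (m + i)))"
      by (simp add: split d_def scaleR_right_distrib sum.distrib mult.commute)
    then have "d i = 0" "d (m + i) = 0"
      using eq \<open>i < m\<close> by (auto intro: independent_familyD[OF ind])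
    then show ?thesis using \<open>i < m\<close> by (auto simp: d_def)
  qed
  then show ?thesis by (auto simp: independent_family_def)
qed

text \<open>The path interpolates the factors. A straight segment between the two matrices would
  have rank \<open>2 * m\<close> in its interior.\<close>

lemma path_component_rank_eq:
  fixes a h :: "nat \<Rightarrow> real^'n1" and b k :: "nat \<Rightarrow> real^'n2"
  assumes a: "independent_family {..<m + m} (\<lambda>i. if i < m then a i else h i)"
    and b: "independent_family {..<m + m} (\<lambda>i. if i < m then b i else k i)"
  shows "path_component {X. rank X = m} (\<Sum>i<m. outer (a i) (b i)) (\<Sum>i<m. outer (h (m + i)) (k (m + i)))"
proof -
  define g where "g t = (\<Sum>i<m. outer ((1 - t) *\<^sub>R a i + t *\<^sub>R h (m + i)) ((1 - t) *\<^sub>R b i + t *\<^sub>R k (m + i)))"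
    for t :: real
  have "path g" unfolding path_def g_def by (intro continuous_intros)
  moreover have "rank (g t) = m" for t
    using rank_sum_outer[OF independent_family_segment[OF a] independent_family_segment[OF b], of t t]
    by (simp add: g_def)
  moreover have "g 0 = (\<Sum>i<m. outer (a i) (b i))" "g 1 = (\<Sum>i<m. outer (h (m + i)) (k (m + i)))"
    by (simp_all add: g_def)
  ultimately show ?thesis
    unfolding path_component_def pathstart_def pathfinish_def path_image_def by blast
qed

text \<open>Two matrices are joined through a third one whose column and row spaces meet those of both
  only in \<open>0\<close>: the rank cannot drop along the two segments.\<close>

lemma connected_rank_eq:
  assumes "2 * m \<le> CARD('n1)" "2 * m \<le> CARD('n2)"
  shows "connected {X :: real^'n2^'n1. rank X = m}"
proof (rule path_connected_imp_connected)
  show "path_connected {X :: real^'n2^'n1. rank X = m}"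
    unfolding path_connected_component
  proof (intro ballI)
    fix X X' :: "real^'n2^'n1" assume "X \<in> {X. rank X = m}" "X' \<in> {X. rank X = m}"
    then have "rank X = m" "rank X' = m" by auto
    obtain a b where ab: "independent_family {..<m} a" "independent_family {..<m} b"
      and X: "X = (\<Sum>i<m. outer (a i) (b i))"
      using rank_factorization[of X] unfolding \<open>rank X = m\<close> by blast
    obtain c d where cd: "independent_family {..<m} c" "independent_family {..<m} d"
      and X': "X' = (\<Sum>i<m. outer (c i) (d i))"
      using rank_factorization[of X'] unfolding \<open>rank X' = m\<close> by blast
    have m: "m + m \<le> DIM(real^'n1)" "m + m \<le> DIM(real^'n2)" using assms by auto
    \<comment> \<open>The same \<open>h\<close>, and likewise \<open>k\<close>, extends both
      families, so the two paths end at the same matrix.\<close>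
    obtain h where
      h: "independent_family {..<m + m} (\<lambda>i. if i < m then a i else h i)"
        "independent_family {..<m + m} (\<lambda>i. if i < m then c i else h i)"
      using ex_common_extension[OF ab(1) cd(1) m(1)] by blast
    obtain k where
      k: "independent_family {..<m + m} (\<lambda>i. if i < m then b i else k i)"
        "independent_family {..<m + m} (\<lambda>i. if i < m then d i else k i)"
      using ex_common_extension[OF ab(2) cd(2) m(2)] by blast
    show "path_component {X. rank X = m} X X'"
      unfolding X X'
      by (rule path_component_trans[OF path_component_rank_eq[OF h(1) k(1)]
            path_component_sym[OF path_component_rank_eq[OF h(2) k(2)]]])
  qed
qed

section \<open>Matrices of rank at most 2r in the null space\<close>

lemma ex_small_multiple:
  fixes g K :: real
  assumes "0 < g" "0 \<le> K"
  obtains e where "0 < e" "e < 1" "e * K \<le> g"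
proof
  \<comment> \<open>The denominator \<open>K + 1\<close> also covers \<open>K = 0\<close>.\<close>
  let ?e = "min (1/2) (g / (K + 1))"
  show "0 < ?e" "?e < 1" using assms by auto
  have "?e * K \<le> g / (K + 1) * K" using assms by (intro mult_right_mono) auto
  also have "\<dots> \<le> g" using assms by (simp add: field_simps)
  finally show "?e * K \<le> g" .
qed

lemma nuclear_norm_diff_le: "nuclear_norm (X - Y) \<le> nuclear_norm X + nuclear_norm Y"
  using nuclear_norm_triangle[of X "- Y"] by simp

text \<open>The gap between \<open>2 * nuclear_norm V\<close> and \<open>nuclear_norm U\<close>
  absorbs the error \<open>e * nuclear_norm E\<close> on each side. The two matrices compared serve
  as \<open>Y2\<close> and \<open>Y1\<close> below.\<close>

lemma nuclear_norm_le_of_perturbation: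
  fixes V U E :: "real^'n2^'n1"
  assumes "0 \<le> e" "e * (2 * nuclear_norm E) \<le> 2 * nuclear_norm V - nuclear_norm U"
  shows "nuclear_norm (U - e *\<^sub>R E) \<le> nuclear_norm (2 *\<^sub>R V + e *\<^sub>R E)"
proof -
  have "2 * nuclear_norm V \<le> nuclear_norm (2 *\<^sub>R V + e *\<^sub>R E) + e * nuclear_norm E"
    using nuclear_norm_diff_le[of "2 *\<^sub>R V + e *\<^sub>R E" "e *\<^sub>R E"] \<open>0 \<le> e\<close>
    by (simp add: nuclear_norm_scaleR)
  moreover have "nuclear_norm (U - e *\<^sub>R E) \<le> nuclear_norm U + e * nuclear_norm E"
    using nuclear_norm_diff_le[of U "e *\<^sub>R E"] \<open>0 \<le> e\<close> by (simp add: nuclear_norm_scaleR)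
  ultimately show ?thesis using assms by (simp add: algebra_simps)
qed

text \<open>Split \<open>Y = P + Q\<close> into parts of rank at most \<open>r\<close> and take twice the larger part as \<open>Y1\<close>,
  perturbed slightly if its rank is less than \<open>r\<close>.\<close>

lemma ex_bad_decomposition_rank_gt:
  fixes Y :: "real^'n2^'n1"
  assumes "r < rank Y" "rank Y \<le> 2 * r"
  shows "\<exists>Y1 Y2. Y = Y1 + Y2 \<and> rank Y1 = r \<and> r < rank Y2 \<and> nuclear_norm Y2 \<le> nuclear_norm Y1"
proof -
  define k where "k = rank Y"
  have k: "r < k" "k \<le> 2 * r" using assms by (auto simp: k_def)
  obtain a b where ab: "independent_family {..<k} a" "independent_family {..<k} b"
    and Y: "Y = (\<Sum>i<k. outer (a i) (b i))"
    unfolding k_def by (rule rank_factorization)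
  define S where "S c = (\<Sum>i<k. c i *\<^sub>R outer (a i) (b i))" for c
  have rk: "rank (S c) = card {i. i < k \<and> c i \<noteq> 0}" for c
    using rank_sum_scaleR_outer[OF ab, of c] by (simp add: S_def)
  have S_add: "S c + S d = S (\<lambda>i. c i + d i)" for c d
    by (simp add: S_def sum.distrib scaleR_left_distrib)
  have S_scale: "t *\<^sub>R S c = S (\<lambda>i. t * c i)" for c t
    by (simp add: S_def scaleR_sum_right)
  have S_diff: "S c - S d = S (\<lambda>i. c i - d i)" for c d
    by (simp add: S_def sum_subtractf scaleR_left_diff_distrib)
  have Y1: "Y = S (\<lambda>_. 1)" by (simp add: Y S_def)
  define P where "P = S (\<lambda>i. if i < r then 1 else 0)"
  define Q where "Q = S (\<lambda>i. if i < r then 0 else 1)"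
  have rest: "Y = S c + S d" if "\<And>i. c i + d i = 1" for c d
    by (simp add: S_add that Y1)
  show ?thesis
  proof (cases "nuclear_norm Q \<le> nuclear_norm P")
    case True
    \<comment> \<open>The choice is \<open>2 *\<^sub>R P\<close> and \<open>Q - P\<close>. No
      coefficient of the latter vanishes, so its rank is \<open>k > r\<close>.\<close>
    let ?c = "\<lambda>i. if i < r then 2 else (0::real)" and ?d = "\<lambda>i. if i < r then -1 else (1::real)"
    have "{i. i < k \<and> ?c i \<noteq> 0} = {..<r}" "{i. i < k \<and> ?d i \<noteq> 0} = {..<k}"
      using k by auto
    then have "rank (S ?c) = r" "rank (S ?d) = k" by (simp_all only: rk card_lessThan)
    moreover have "S ?c = 2 *\<^sub>R P" "S ?d = Q - P"
      unfolding P_def Q_def S_scale S_diff by (rule arg_cong[of _ _ S], force)+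
    then have "nuclear_norm (S ?d) \<le> nuclear_norm (S ?c)"
      using True nuclear_norm_diff_le[of Q P] by (simp add: nuclear_norm_scaleR)
    moreover have "Y = S ?c + S ?d" by (rule rest) simp
    ultimately show ?thesis
      using k by (intro exI[of _ "S ?c"] exI[of _ "S ?d"] conjI) simp_all
  next
    case False
    \<comment> \<open>Twice \<open>Q\<close> has only rank \<open>k - r\<close>. The
      \<open>2 * r - k\<close> terms of \<open>E\<close> lie inside \<open>P\<close> and raise this
      to exactly \<open>r\<close>, while \<open>e < 1\<close> keeps every coefficient
      \<open>1 - e\<close> of the other part nonzero.\<close>
    define E where "E = S (\<lambda>i. if i < 2 * r - k then 1 else 0)"
    obtain e where e: "0 < e" "e < 1" "e * (2 * nuclear_norm E) \<le> nuclear_norm Q - nuclear_norm P"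
      using ex_small_multiple[of "nuclear_norm Q - nuclear_norm P" "2 * nuclear_norm E"] False
        nuclear_norm_nonneg[of E] by auto
    let ?c = "\<lambda>i. if i < 2 * r - k then e else if i < r then 0 else 2"
    let ?d = "\<lambda>i. 1 - ?c i"
    have "{i. i < k \<and> ?c i \<noteq> 0} = {..<2 * r - k} \<union> {r..<k}" "{i. i < k \<and> ?d i \<noteq> 0} = {..<k}"
      using k e by auto
    moreover have "card ({..<2 * r - k} \<union> {r..<k}) = r"
      using k by (subst card_Un_disjoint) auto
    ultimately have "rank (S ?c) = r" "rank (S ?d) = k" by (simp_all only: rk card_lessThan)
    moreover have "S ?c = 2 *\<^sub>R Q + e *\<^sub>R E" "S ?d = (P - Q) - e *\<^sub>R E"
      unfolding P_def Q_def E_def S_scale S_diff S_add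
      using k by (intro arg_cong[of _ _ S] ext, force)+
    then have "nuclear_norm (S ?d) \<le> nuclear_norm (S ?c)"
      using nuclear_norm_le_of_perturbation[of e E Q "P - Q"] e nuclear_norm_diff_le[of P Q] by simp
    moreover have "Y = S ?c + S ?d" by (rule rest) simp
    ultimately show ?thesis
      using k by (intro exI[of _ "S ?c"] exI[of _ "S ?d"] conjI) simp_all
  qed
qed

text \<open>\<open>Y1\<close> is a small perturbation of \<open>2 *\<^sub>R Y\<close>. Tilting both factors of one rank-one term by a new
  direction makes that term independent of the corresponding term of \<open>Y\<close>, so that the rank of
  \<open>Y - Y1\<close> rises to \<open>r + 1\<close>.\<close>

lemma ex_bad_decomposition_rank_le:
  fixes Y :: "real^'n2^'n1"
  assumes "Y \<noteq> 0" "rank Y \<le> r" "r < CARD('n1)" "r < CARD('n2)"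
  shows "\<exists>Y1 Y2. Y = Y1 + Y2 \<and> rank Y1 = r \<and> r < rank Y2 \<and> nuclear_norm Y2 \<le> nuclear_norm Y1"
proof -
  define k where "k = rank Y"
  have k: "0 < k" "k \<le> r" using assms rank_eq_0[of Y] by (auto simp: k_def)
  obtain a' b' where ab': "independent_family {..<k} a'" "independent_family {..<k} b'"
    and Y': "Y = (\<Sum>i<k. outer (a' i) (b' i))"
    unfolding k_def by (rule rank_factorization)
  have Suc_r: "Suc r = k + (Suc r - k)" using k by simp
  have "\<exists>a. independent_family {..<Suc r} a \<and> (\<forall>i<k. a i = a' i)"
    using ex_common_extension[OF ab'(1) ab'(1), of "Suc r - k"] assms Suc_r by fastforce
  then obtain a where a: "independent_family {..<Suc r} a" "\<And>i. i < k \<Longrightarrow> a i = a' i" by blast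
  have "\<exists>b. independent_family {..<Suc r} b \<and> (\<forall>i<k. b i = b' i)"
    using ex_common_extension[OF ab'(2) ab'(2), of "Suc r - k"] assms Suc_r by fastforce
  then obtain b where b: "independent_family {..<Suc r} b" "\<And>i. i < k \<Longrightarrow> b i = b' i" by blast
  have Y: "Y = (\<Sum>i<k. outer (a i) (b i))"
    by (simp add: Y' a b)
  \<comment> \<open>\<open>F\<close> pads the rank of \<open>Y1\<close>. The tilted term
    \<open>outer (a 0 + e *\<^sub>R a r) (b 0 + e *\<^sub>R b r)\<close> equals
    \<open>outer (a 0) (b 0) + e *\<^sub>R (G + e *\<^sub>R H)\<close>.\<close>
  define F where "F = (\<Sum>i\<in>{k..<r}. outer (a i) (b i))"
  define G where "G = outer (a 0) (b r) + outer (a r) (b 0)"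
  define H where "H = outer (a r) (b r)"
  \<comment> \<open>The perturbation \<open>E\<close> will depend on \<open>e\<close>. The constant
    \<open>K\<close> bounds its nuclear norm for every \<open>e\<close> between 0 and 1, so
    \<open>e\<close> can be chosen first.\<close>
  define K where "K = 2 * (nuclear_norm G + nuclear_norm H) + nuclear_norm F"
  have "0 \<le> K" by (simp add: K_def nuclear_norm_nonneg)
  then obtain e where e: "0 < e" "e < 1" "e * (2 * K) \<le> nuclear_norm Y"
    using ex_small_multiple[of "nuclear_norm Y" "2 * K"] nuclear_norm_pos[OF \<open>Y \<noteq> 0\<close>] by auto
  define E where "E = 2 *\<^sub>R (G + e *\<^sub>R H) + F"
  have "nuclear_norm E \<le> K"
  proof -
    have "nuclear_norm E \<le> 2 * nuclear_norm (G + e *\<^sub>R H) + nuclear_norm F"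
      unfolding E_def using nuclear_norm_triangle[of "2 *\<^sub>R (G + e *\<^sub>R H)" F]
        nuclear_norm_scaleR[of 2 "G + e *\<^sub>R H"]
      by linarith
    also have "\<dots> \<le> K"
    proof -
      have "e * nuclear_norm H \<le> 1 * nuclear_norm H"
        using e by (intro mult_right_mono nuclear_norm_nonneg) auto
      then have "nuclear_norm (G + e *\<^sub>R H) \<le> nuclear_norm G + nuclear_norm H"
        using nuclear_norm_triangle[of G "e *\<^sub>R H"] e by (simp add: nuclear_norm_scaleR)
      then show ?thesis unfolding K_def by simp
    qed
    finally show ?thesis .
  qed
  then have "e * (2 * nuclear_norm E) \<le> e * (2 * K)"
    using e by simp
  also have "\<dots> \<le> 2 * nuclear_norm Y - nuclear_norm (- Y)"
    using e by simp
  finally have le: "nuclear_norm (- Y - e *\<^sub>R E) \<le> nuclear_norm (2 *\<^sub>R Y + e *\<^sub>R E)"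
    using e by (intro nuclear_norm_le_of_perturbation) auto
  \<comment> \<open>The tilted vector stays outside the span of the first \<open>r\<close> members
    because \<open>e\<close> is nonzero.\<close>
  have ext: "independent_family {..<Suc r} (f(r := f 0 + e *\<^sub>R f r))"
    if f: "independent_family {..<Suc r} f" for f :: "nat \<Rightarrow> 'x::real_vector"
  proof -
    have f': "independent_family {..<r} f" by (rule independent_family_subset[OF f]) auto
    have "f ` {..<r} = f ` {..<Suc r} - {f r}"
      using independent_family_inj[OF f] by (auto simp: inj_on_def less_Suc_eq)
    then have "f r \<notin> span (f ` {..<r})"
      using independent_family_independent[OF f] by (auto simp: dependent_def)
    moreover have "f 0 \<in> span (f ` {..<r})" using k by (intro span_base) auto
    ultimately have "f 0 + e *\<^sub>R f r \<notin> span (f ` {..<r})"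
      using e span_scale[of "e *\<^sub>R f r" _ "inverse e"] by (auto simp: span_add_eq)
    then show ?thesis
      using independent_family_insert[OF f', of _ r] by (simp add: lessThan_Suc)
  qed
  let ?f = "a(r := a 0 + e *\<^sub>R a r)" and ?g = "b(r := b 0 + e *\<^sub>R b r)"
  define S where "S c = (\<Sum>i<Suc r. c i *\<^sub>R outer (?f i) (?g i))" for c
  have rk: "rank (S c) = card {i. i < Suc r \<and> c i \<noteq> 0}" for c
    using rank_sum_scaleR_outer[OF ext[OF a(1)] ext[OF b(1)], of c]
    unfolding S_def[symmetric] by simp
  have Sc: "S c = (c 0 - s) *\<^sub>R outer (a 0) (b 0) + s *\<^sub>R Y + t *\<^sub>R F +
      c r *\<^sub>R (outer (a 0) (b 0) + e *\<^sub>R (G + e *\<^sub>R H))"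
    if c: "\<And>i. 0 < i \<Longrightarrow> i < k \<Longrightarrow> c i = s" "\<And>i. k \<le> i \<Longrightarrow> i < r \<Longrightarrow> c i = t" for c s t
  proof -
    have "S c = (\<Sum>i<r. c i *\<^sub>R outer (a i) (b i)) + c r *\<^sub>R outer (?f r) (?g r)"
      unfolding S_def sum.lessThan_Suc by simp
    also have "(\<Sum>i<r. c i *\<^sub>R outer (a i) (b i)) =
        (\<Sum>i<k. c i *\<^sub>R outer (a i) (b i)) + (\<Sum>i\<in>{k..<r}. c i *\<^sub>R outer (a i) (b i))"
      using k by (simp add: lessThan_atLeast0 sum.atLeastLessThan_concat)
    also have "(\<Sum>i\<in>{k..<r}. c i *\<^sub>R outer (a i) (b i)) = t *\<^sub>R F"
      unfolding F_def scaleR_sum_right using c(2) by (intro sum.cong) auto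
    also have "(\<Sum>i<k. c i *\<^sub>R outer (a i) (b i)) =
        (\<Sum>i<k. (if i = 0 then (c 0 - s) *\<^sub>R outer (a 0) (b 0) else 0) + s *\<^sub>R outer (a i) (b i))"
      using c(1) by (intro sum.cong) (auto simp: scaleR_left_diff_distrib)
    also have "\<dots> = (c 0 - s) *\<^sub>R outer (a 0) (b 0) + s *\<^sub>R Y"
      using k by (simp add: sum.distrib Y scaleR_sum_right)
    finally show ?thesis
      by (simp add: G_def H_def outer_add_left outer_add_right outer_scaleR_left outer_scaleR_right
          algebra_simps)
  qed
  \<comment> \<open>The coefficients add up to 1 on the terms of \<open>Y\<close> and to 0 on the
    padding and tilted terms. In \<open>?c\<close>, the tilted term replaces term 0, which gives
    rank \<open>r\<close>; in \<open>?d\<close> none of the \<open>r + 1\<close> coefficients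
    vanishes.\<close>
  let ?c = "\<lambda>i. if i = 0 then 0 else if i < k \<or> i = r then 2 else e"
  let ?d = "\<lambda>i. if i = 0 then 1 else if i < k then -1 else if i = r then -2 else - e"
  have "S ?c = 2 *\<^sub>R Y + e *\<^sub>R E"
    using k by (subst Sc[of _ 2 e]) (auto simp: E_def algebra_simps)
  moreover have "S ?d = - Y - e *\<^sub>R E"
    using k by (subst Sc[of _ "-1" "- e"]) (auto simp: E_def algebra_simps)
  moreover have "{i. i < Suc r \<and> ?c i \<noteq> 0} = {1..r}" "{i. i < Suc r \<and> ?d i \<noteq> 0} = {..<Suc r}"
    using k e by auto
  then have "rank (S ?c) = r" "rank (S ?d) = Suc r"
    by (simp_all only: rk card_lessThan card_atLeastAtMost)
  ultimately show ?thesis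
    using le by (intro exI[of _ "S ?c"] exI[of _ "S ?d"]) (simp add: scaleR_2)
qed

text \<open>The two constructions cover all nonzero matrices of rank at most \<open>2 * r\<close>.
  Consequently two solutions of rank \<open>r\<close> must coincide.\<close>

lemma null_space_condition_imp_rank_gt:
  fixes A :: "real^'n2^'n1 \<Rightarrow> real^'m"
  assumes "null_space_condition A r" "A Y = 0" "Y \<noteq> 0" "2 * r < CARD('n1)" "CARD('n1) \<le> CARD('n2)"
  shows "2 * r < rank Y"
proof (rule ccontr)
  assume "\<not> 2 * r < rank Y"
  then obtain Y1 Y2 where "Y = Y1 + Y2" "rank Y1 = r" "r < rank Y2" "nuclear_norm Y2 \<le> nuclear_norm Y1"
    using ex_bad_decomposition_rank_gt[of r Y] ex_bad_decomposition_rank_le[of Y r] assms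
    by (cases "rank Y \<le> r") force+
  then show False
    using assms unfolding null_space_condition_def by (metis not_le)
qed

section \<open>Minimum rank solutions that are minimum nuclear norm solutions\<close>

text \<open>Compactness of the unit sphere among the matrices of rank at most \<open>p\<close> gives
  \<open>c * norm Z \<le> norm (A Z)\<close> with \<open>c > 0\<close>. A convergent sequence of
  images then has preimages in a compact set.\<close>

lemma closed_image_rank_le:
  fixes A :: "real^'n2^'n1 \<Rightarrow> 'b::euclidean_space"
  assumes A: "linear A" and inj: "\<And>Z. rank Z \<le> p \<Longrightarrow> A Z = 0 \<Longrightarrow> Z = 0"
  shows "closed (A ` {Z. rank Z \<le> p})"
proof -
  interpret A: linear A by (rule A)
  have cont: "continuous_on S A" for S
    using A by (intro linear_continuous_on linear_conv_bounded_linear[THEN iffD1])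
  let ?K = "{Z. rank Z \<le> p} \<inter> sphere (0 :: real^'n2^'n1) 1"
  obtain c where "0 < c" and c1: "\<And>Z. Z \<in> ?K \<Longrightarrow> c \<le> norm (A Z)"
  proof (cases "?K = {}")
    case True
    \<comment> \<open>This is the case \<open>p = 0\<close>, where any positive constant
      works.\<close>
    show thesis by (rule that[of 1]) (use True in auto)
  next
    case False
    moreover have "compact ?K"
      by (metis closed_rank_le closed_Int_compact compact_sphere)
    moreover have "continuous_on ?K (\<lambda>Z. norm (A Z))"
      by (intro continuous_intros cont)
    ultimately obtain U where U: "U \<in> ?K" "\<And>Z. Z \<in> ?K \<Longrightarrow> norm (A U) \<le> norm (A Z)"
      using continuous_attains_inf by metis
    then have "A U \<noteq> 0" using inj[of U] by auto
    then show thesis using that[of "norm (A U)"] U(2) by auto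
  qed
  have c: "c * norm Z \<le> norm (A Z)" if "rank Z \<le> p" for Z
  proof (cases "Z = 0")
    case False
    then have "Z /\<^sub>R norm Z \<in> ?K" using that by (simp add: rank_scaleR)
    from c1[OF this] False show ?thesis by (simp add: A.scale field_simps)
  qed (simp add: A.zero)
  show ?thesis
    unfolding closed_sequential_limits
  proof (intro allI impI, elim conjE)
    fix x l assume x: "\<forall>n. x n \<in> A ` {Z. rank Z \<le> p}" and lim: "x \<longlonglongrightarrow> l"
    obtain M where M: "\<And>n. norm (x n) \<le> M"
      using convergent_imp_Bseq[OF convergentI[OF lim]] by (auto simp: Bseq_def)
    let ?S = "{Z :: real^'n2^'n1. rank Z \<le> p} \<inter> cball 0 (M / c)"
    have "x n \<in> A ` ?S" for n
    proof -
      obtain Z where Z: "rank Z \<le> p" "x n = A Z" using x by blast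
      then have "norm Z \<le> M / c"
        using c[OF Z(1)] M[of n] \<open>0 < c\<close> by (simp add: field_simps)
      then show ?thesis using Z by auto
    qed
    moreover have "compact ?S" by (metis closed_rank_le closed_Int_compact compact_cball)
    then have "closed (A ` ?S)"
      by (intro compact_imp_closed compact_continuous_image cont)
    ultimately have "l \<in> A ` ?S"
      using lim by (meson closed_sequentially)
    then show "l \<in> A ` {Z. rank Z \<le> p}" by blast
  qed
qed

text \<open>The core of part 2. The hypothesis \<open>min\<close> is the pointwise form of equality
  of the two solution sets: a minimum rank solution of rank at most \<open>r\<close> has minimal
  nuclear norm, and a competitor tying with it also has minimal rank.\<close>

lemma rank_ge_if_rank_minimal_solutions_nuclear_minimal:
  fixes A :: "real^'n2^'n1 \<Rightarrow> real^'m"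
  assumes A: "linear A" and n: "2 * r < CARD('n1)" "CARD('n1) \<le> CARD('n2)"
    and X0: "rank X0 = r" "\<And>Z. A Z = A X0 \<Longrightarrow> r \<le> rank Z"
    and min: "\<And>X Z. rank X \<le> r \<Longrightarrow> (\<And>V. A V = A X \<Longrightarrow> rank X \<le> rank V) \<Longrightarrow> A Z = A X \<Longrightarrow>
      nuclear_norm X \<le> nuclear_norm Z \<and> (nuclear_norm Z \<le> nuclear_norm X \<longrightarrow> rank Z \<le> rank X)"
    and W: "A W = 0" "W \<noteq> 0"
  shows "2 * r \<le> rank W"
proof (rule ccontr)
  assume "\<not> 2 * r \<le> rank W"
  interpret A: linear A by (rule A)
  obtain N where N: "A N = 0" "N \<noteq> 0" and Nmin: "\<And>V. A V = 0 \<Longrightarrow> V \<noteq> 0 \<Longrightarrow> rank N \<le> rank V"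
    using ex_has_least_nat[of "\<lambda>V. A V = 0 \<and> V \<noteq> 0" W rank] W by auto
  define k where "k = rank N"
  have k: "0 < k" "k < 2 * r"
    using \<open>\<not> 2 * r \<le> rank W\<close> Nmin[OF W] N rank_eq_0[of N] by (auto simp: k_def)
  obtain a b where ab: "independent_family {..<k} a" "independent_family {..<k} b"
    and N_eq: "N = (\<Sum>i<k. outer (a i) (b i))"
    unfolding k_def by (rule rank_factorization)
  \<comment> \<open>The least rank \<open>k\<close> of a nonzero null vector is what makes
    \<open>A\<close> injective on low rank.\<close>
  have uniq: "U = V" if "A U = A V" "rank U + rank V < k" for U V
  proof (rule ccontr)
    assume "U \<noteq> V"
    then have "k \<le> rank (U - V)"
      unfolding k_def using that(1) by (intro Nmin) (auto simp: A.diff)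
    then show False using rank_diff_le[of U V] that(2) by linarith
  qed
  define S where "S c = (\<Sum>i<k. c i *\<^sub>R outer (a i) (b i))" for c
  have rk: "rank (S c) = card {i. i < k \<and> c i \<noteq> 0}" for c
    using rank_sum_scaleR_outer[OF ab, of c] by (simp add: S_def)
  have S_diff: "S c - S d = S (\<lambda>i. c i - d i)" for c d
    by (simp add: S_def sum_subtractf scaleR_left_diff_distrib)
  have N_S: "N = S (\<lambda>_. 1)" by (simp add: N_eq S_def)
  have A_S: "A (S c) = A (S d)" if "\<And>i. c i - d i = 1" for c d
  proof -
    have "S c - S d = N" by (simp add: S_diff that N_S)
    then show ?thesis using N(1) A.diff[of "S c" "S d"] by simp
  qed
  show False
  proof (cases "even k")
    case True
    then obtain q where q: "k = 2 * q" by (rule evenE)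
    let ?p = "\<lambda>i. if i < q then 1 else (0::real)" and ?q = "\<lambda>i. if i < q then 0 else (-1::real)"
    let ?m = "\<lambda>i. if i < q then 1/2 else (-1/2::real)"
    have "{i. i < k \<and> ?p i \<noteq> 0} = {..<q}" "{i. i < k \<and> ?q i \<noteq> 0} = {q..<k}"
      "{i. i < k \<and> ?m i \<noteq> 0} = {..<k}"
      using q by auto
    then have rks: "rank (S ?p) = q" "rank (S ?q) = q" "rank (S ?m) = k"
      using q by (simp_all only: rk card_lessThan card_atLeastLessThan)
    have eq: "A (S ?p) = A (S ?q)" by (rule A_S) auto
    \<comment> \<open>Every matrix of rank \<open>q\<close> is a minimum rank solution for its own
      image: together with a solution of smaller rank, the ranks would add up to less than
      \<open>k = 2 * q\<close>.\<close>
    have minq: "nuclear_norm U \<le> nuclear_norm V \<and> (nuclear_norm V \<le> nuclear_norm U \<longrightarrow> rank V \<le> q)"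
      if U: "rank U = q" and V: "A V = A U" for U V
    proof -
      have "rank U \<le> rank V'" if "A V' = A U" for V'
        using uniq[of V' U] that U q by (cases "rank V' < q") auto
      moreover have "rank U \<le> r" using U q k by simp
      ultimately show ?thesis using min[of U V] V U by blast
    qed
    have mid: "S ?m = (1/2) *\<^sub>R S ?p + (1/2) *\<^sub>R S ?q"
      unfolding S_def scaleR_sum_right sum.distrib[symmetric] by (intro sum.cong) auto
    have "nuclear_norm (S ?m) \<le> (1/2) * nuclear_norm (S ?p) + (1/2) * nuclear_norm (S ?q)"
      using nuclear_norm_triangle[of "(1/2) *\<^sub>R S ?p" "(1/2) *\<^sub>R S ?q"]
      unfolding mid nuclear_norm_scaleR by simp
    moreover have "nuclear_norm (S ?q) \<le> nuclear_norm (S ?p)"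
      using minq[OF rks(2) eq] by blast
    ultimately have "nuclear_norm (S ?m) \<le> nuclear_norm (S ?p)" by argo
    moreover have "A (S ?m) = A (S ?p)"
      unfolding mid A.add A.scale eq[symmetric] scaleR_left_distrib[symmetric] by simp
    ultimately have "rank (S ?m) \<le> q"
      using minq[OF rks(1)] by blast
    then show False using rks(3) q k by simp
  next
    case False
    then obtain p where p: "k = 2 * p + 1" by (rule oddE)
    define R where "R = {X :: real^'n2^'n1. rank X = Suc p}"
    define T where "T = R \<inter> A -` (A ` {Z. rank Z \<le> p})"
    have cont: "continuous_on U A" for U
      using A by (intro linear_continuous_on linear_conv_bounded_linear[THEN iffD1])
    have low: "rank Z \<le> p \<Longrightarrow> A Z = 0 \<Longrightarrow> Z = 0" for Z
      using uniq[of Z 0] p by (simp add: A.zero)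
    \<comment> \<open>Here \<open>2 * Suc p = k + 1\<close>, which is at most \<open>2 * r\<close>
      because \<open>k\<close> is odd and less than \<open>2 * r\<close>.\<close>
    have "connected R"
      unfolding R_def using n k p by (intro connected_rank_eq) auto
    moreover have "closedin (top_of_set R) T"
      unfolding T_def by (intro continuous_closedin_preimage cont closed_image_rank_le A low)
    moreover have "openin (top_of_set R) T"
    proof (subst openin_subopen, intro ballI)
      fix X assume "X \<in> T"
      then obtain Z where X: "rank X = Suc p" and Z: "rank Z \<le> p" "A Z = A X"
        by (auto simp: T_def R_def)
      \<comment> \<open>By \<open>uniq\<close>, \<open>Z\<close> is a minimum rank solution. Since
        \<open>X\<close> has larger rank, \<open>min\<close> excludes a tie.\<close>
      have "nuclear_norm Z < nuclear_norm X"
      proof -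
        have "rank Z \<le> rank V" if "A V = A Z" for V
        proof (rule ccontr)
          assume "\<not> rank Z \<le> rank V"
          moreover from this have "V = Z" using Z(1) p that by (intro uniq) auto
          ultimately show False by simp
        qed
        moreover have "rank Z \<le> r" using Z(1) k p by simp
        ultimately have "nuclear_norm X \<le> nuclear_norm Z \<longrightarrow> rank X \<le> rank Z"
          using min[of Z X] Z(2)[symmetric] by blast
        then have "\<not> nuclear_norm X \<le> nuclear_norm Z" using X Z(1) by linarith
        then show ?thesis by simp
      qed
      \<comment> \<open>For \<open>X'\<close> near \<open>X\<close>, translating \<open>Z\<close> by
        \<open>X' - X\<close> gives a solution for \<open>A X'\<close> that still has smaller
        nuclear norm.\<close>
      let ?O = "{X'. nuclear_norm (X' - X + Z) < nuclear_norm X'}"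
      have "open ?O"
        by (intro open_Collect_less continuous_on_compose2[OF continuous_on_nuclear_norm]
            continuous_intros) auto
      then have "openin (top_of_set R) (R \<inter> ?O)" by blast
      moreover have "X \<in> R \<inter> ?O"
        using X \<open>nuclear_norm Z < nuclear_norm X\<close> by (simp add: R_def)
      moreover have "R \<inter> ?O \<subseteq> T"
      proof
        fix X' assume X': "X' \<in> R \<inter> ?O"
        show "X' \<in> T"
        proof (rule ccontr)
          assume "X' \<notin> T"
          have "rank X' \<le> rank V" if "A V = A X'" for V
          proof -
            have "A V \<notin> A ` {Z. rank Z \<le> p}"
              using \<open>X' \<notin> T\<close> X' unfolding that by (auto simp: T_def)
            then have "\<not> rank V \<le> p" by blast
            then show ?thesis using X' by (simp add: R_def)
          qed
          moreover have "A (X' - X + Z) = A X'" using Z by (simp add: A.add A.diff)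
          moreover have "rank X' \<le> r" using X' k p by (simp add: R_def)
          ultimately have "nuclear_norm X' \<le> nuclear_norm (X' - X + Z)"
            using min[of X' "X' - X + Z"] by blast
          then show False using X' by simp
        qed
      qed
      ultimately show "\<exists>U. openin (top_of_set R) U \<and> X \<in> U \<and> U \<subseteq> T" by blast
    qed
    ultimately have "T = {} \<or> T = R"
      using connected_clopen by blast
    moreover have "T \<noteq> {}"
    proof -
      let ?p = "\<lambda>i. if i < Suc p then 1 else (0::real)" and ?q = "\<lambda>i. if i < Suc p then 0 else (-1::real)"
      have "{i. i < k \<and> ?p i \<noteq> 0} = {..<Suc p}" "{i. i < k \<and> ?q i \<noteq> 0} = {Suc p..<k}"
        using p by auto
      then have "rank (S ?p) = Suc p" "rank (S ?q) = p"
        using p by (simp_all only: rk card_lessThan card_atLeastLessThan)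
      moreover have "A (S ?p) = A (S ?q)" by (rule A_S) auto
      ultimately have "S ?p \<in> T" by (force simp: T_def R_def)
      then show ?thesis by blast
    qed
    moreover have "T \<noteq> R"
    proof
      assume "T = R"
      obtain u v where uv: "independent_family {..<r} u" "independent_family {..<r} v"
        and X0_eq: "X0 = (\<Sum>i<r. outer (u i) (v i))"
        using rank_factorization[of X0] unfolding X0(1) by blast
      have pr: "Suc p \<le> r" using k p by simp
      have rank_part: "rank (\<Sum>i\<in>J. outer (u i) (v i)) = card J" if "J \<subseteq> {..<r}" for J
        using that by (intro rank_sum_outer independent_family_subset[OF uv(1)]
            independent_family_subset[OF uv(2)])
      let ?X1 = "\<Sum>i<Suc p. outer (u i) (v i)" and ?X2 = "\<Sum>i\<in>{Suc p..<r}. outer (u i) (v i)"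
      have X12: "X0 = ?X1 + ?X2"
        unfolding X0_eq lessThan_atLeast0 using pr by (subst sum.atLeastLessThan_concat) auto
      have "?X1 \<in> R" using rank_part[of "{..<Suc p}"] pr unfolding R_def by simp
      then have "?X1 \<in> T" by (simp only: \<open>T = R\<close>)
      then have "A ?X1 \<in> A ` {Z. rank Z \<le> p}" unfolding T_def by blast
      then obtain Z where Z: "rank Z \<le> p" "A Z = A ?X1" by auto
      \<comment> \<open>Replacing the first \<open>p + 1\<close> terms of \<open>X0\<close> by
        \<open>Z\<close> gives a solution of rank at most
        \<open>p + (r - Suc p) < r\<close>.\<close>
      then have "A (Z + ?X2) = A X0" unfolding X12 by (simp only: A.add)
      then have "r \<le> rank (Z + ?X2)" by (rule X0(2))
      also have "\<dots> \<le> rank Z + rank ?X2" by (rule rank_add_le)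
      also have "rank ?X2 = r - Suc p" by (subst rank_part) auto
      finally show False using Z(1) pr by linarith
    qed
    ultimately show False by blast
  qed
qed

text \<open>Minimizers for \<open>b'\<close> need not be unique, so part 2 compares the solution
  sets. The existence of a minimum rank solution keeps the rank bound from being vacuous.\<close>

theorem theorem1p1:
  fixes A :: "real^'n2^'n1 \<Rightarrow> real^'m"
    and b :: "real^'m"
    and X0 :: "real^'n2^'n1"
    and r :: nat
  assumes "CARD('n1) \<le> CARD('n2)"
    and "linear A"
    and "X0 \<in> min_rank_solutions A b"
    and "rank X0 = r"
    and "real r < real CARD('n1) / 2"
  shows "(null_space_condition A r \<longrightarrow> min_nuclear_solutions A b = {X0}) \<and>
         (\<not> null_space_condition A r \<longrightarrow>
            (\<exists>b' :: real^'m.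
               (\<exists>X. X \<in> min_rank_solutions A b') \<and>
               (\<forall>X \<in> min_rank_solutions A b'. rank X \<le> r) \<and>
               min_rank_solutions A b' \<noteq> min_nuclear_solutions A b'))"
proof (intro conjI impI)
  interpret A: linear A by (rule \<open>linear A\<close>)
  have r: "2 * r < CARD('n1)" using assms(5) by linarith
  have mem_rank: "X \<in> min_rank_solutions A c \<longleftrightarrow> A X = c \<and> (\<forall>Z. A Z = c \<longrightarrow> rank X \<le> rank Z)" for X c
    by (auto simp: min_rank_solutions_def is_arg_min_def not_less)
  have mem_nuc: "X \<in> min_nuclear_solutions A c \<longleftrightarrow>
      A X = c \<and> (\<forall>Z. A Z = c \<longrightarrow> nuclear_norm X \<le> nuclear_norm Z)" for X c
    by (auto simp: min_nuclear_solutions_def is_arg_min_def not_less)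
  have X0: "A X0 = b" "\<And>Z. A Z = b \<Longrightarrow> r \<le> rank Z"
    using assms(3,4) by (auto simp: mem_rank)
  {
    assume cond: "null_space_condition A r"
    have less: "nuclear_norm X0 < nuclear_norm Z" if Z: "A Z = b" "Z \<noteq> X0" for Z
    proof (cases "rank Z = r")
      case True
      have "2 * r < rank (X0 - Z)"
        using Z X0(1) r assms(1)
        by (intro null_space_condition_imp_rank_gt[OF cond]) (auto simp: A.diff)
      then show ?thesis using rank_diff_le[of X0 Z] True assms(4) by simp
    next
      case False
      then have "r < rank (- Z)" using X0(2)[OF Z(1)] by simp
      moreover have "A (X0 + - Z) = 0" using Z X0(1) by (simp add: A.diff)
      ultimately have "nuclear_norm X0 < nuclear_norm (- Z)"
        using cond assms(4) unfolding null_space_condition_def by blast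
      then show ?thesis by simp
    qed
    show "min_nuclear_solutions A b = {X0}"
    proof (intro equalityI subsetI)
      fix X assume "X \<in> min_nuclear_solutions A b"
      then have "A X = b" "\<not> nuclear_norm X0 < nuclear_norm X"
        using X0(1) by (auto simp: mem_nuc not_less)
      then show "X \<in> {X0}" using less[of X] by blast
    next
      fix X assume "X \<in> {X0}"
      moreover have "nuclear_norm X0 \<le> nuclear_norm Z" if "A Z = b" for Z
        using less[OF that] by (cases "Z = X0") auto
      ultimately show "X \<in> min_nuclear_solutions A b"
        using X0(1) by (simp add: mem_nuc)
    qed
  next
    assume "\<not> null_space_condition A r"
    then obtain Y1 Y2 where Y: "A (Y1 + Y2) = 0" "rank Y1 = r" "r < rank Y2"
      and le: "nuclear_norm Y2 \<le> nuclear_norm Y1"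
      unfolding null_space_condition_def by (auto simp: not_less)
    show "\<exists>b'. (\<exists>X. X \<in> min_rank_solutions A b') \<and>
        (\<forall>X \<in> min_rank_solutions A b'. rank X \<le> r) \<and>
        min_rank_solutions A b' \<noteq> min_nuclear_solutions A b'"
    proof (rule ccontr)
      assume no_b: "\<not> ?thesis"
      have eq: "min_rank_solutions A c = min_nuclear_solutions A c"
        if "X \<in> min_rank_solutions A c" "rank X \<le> r" for X c
      proof -
        have "rank Z \<le> r" if "Z \<in> min_rank_solutions A c" for Z
        proof -
          have "rank Z \<le> rank X"
            using that \<open>X \<in> min_rank_solutions A c\<close> unfolding mem_rank by blast
          then show ?thesis using \<open>rank X \<le> r\<close> by simp
        qed
        then show ?thesis using no_b that by blast
      qed
      have min: "nuclear_norm X \<le> nuclear_norm Z \<and> (nuclear_norm Z \<le> nuclear_norm X \<longrightarrow> rank Z \<le> rank X)"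
        if X: "rank X \<le> r" "\<And>V. A V = A X \<Longrightarrow> rank X \<le> rank V" and Z: "A Z = A X" for X Z
      proof -
        have "X \<in> min_rank_solutions A (A X)" using X by (simp add: mem_rank)
        note eq' = eq[OF this X(1)] and this
        then have nuc: "X \<in> min_nuclear_solutions A (A X)" by blast
        then have "nuclear_norm X \<le> nuclear_norm Z" using Z by (simp add: mem_nuc)
        moreover have "rank Z \<le> rank X" if "nuclear_norm Z \<le> nuclear_norm X"
        proof -
          have "Z \<in> min_nuclear_solutions A (A X)"
            using nuc that Z by (auto simp: mem_nuc intro: order_trans)
          then have "Z \<in> min_rank_solutions A (A X)" by (simp only: eq')
          then show ?thesis by (simp add: mem_rank)
        qed
        ultimately show ?thesis by blast
      qed
      have AY: "A (- Y2) = A Y1" 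
        using Y(1) neg_eq_iff_add_eq_0[of "A Y2" "A Y1"] by (simp add: A.add A.neg add.commute)
      show False
      \<comment> \<open>If \<open>Y1\<close> is a minimum rank solution, then \<open>- Y2\<close>
        competes with it at no larger nuclear norm but larger rank. Otherwise a solution
        \<open>V\<close> of rank below \<open>r\<close> gives the null vector \<open>Y1 - V\<close>
        of rank below \<open>2 * r\<close>.\<close>
      proof (cases "\<forall>V. A V = A Y1 \<longrightarrow> rank Y1 \<le> rank V")
        case True
        then have "rank (- Y2) \<le> rank Y1"
          using min[of Y1 "- Y2"] Y(2) AY le by (metis nuclear_norm_minus order_refl)
        then show False using Y by simp
      next
        case False
        then obtain V where V: "A V = A Y1" "rank V < r" using Y(2) by auto
        have "2 * r \<le> rank (Y1 - V)"
        proof (rule rank_ge_if_rank_minimal_solutions_nuclear_minimal[OF \<open>linear A\<close> r assms(1,4) _ min])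
          show "A (Y1 - V) = 0" "Y1 - V \<noteq> 0" using V Y(2) by (auto simp: A.diff)
        qed (use X0 in auto)
        then show False using rank_diff_le[of Y1 V] V Y(2) by simp
      qed
    qed
  }
qed

end
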